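(* (1) If $\mathbf A\in\mathsf{BCRL}$ is a finite subdirectly irreducible algebra, then the variety generated by $\mathbf A$ is almost minimal in the lattice of subvarieties of $\mathsf{BCRL}$ if and only if $\mathbf A$ is rigid. (2) If $\mathbf A\in\mathsf{BCRL}$ is such that its $0$-free reduct is a tight algebra in $\mathsf{CIRL}$, then $\mathbf A$ is rigid.
   Context: $\mathsf{CIRL}$ is the variety of commutative integral residuated lattices $(A,\vee,\wedge,\cdot,\to,1)$: $(A,\vee,\wedge)$ a lattice, $(A,\cdot,1)$ a commutative monoid, $ab\le c$ iff $a\le b\to c$, and $1$ the greatest element. $\mathsf{BCRL}$ is the variety of bounded commutative residuated lattices: members of $\mathsf{CIRL}$ expanded by a constant $0$ that is the least element. An algebra $\mathbf A\in\mathsf{BCRL}$ is rigid if $|A|>2$, $\mathbf A$ is subdirectly irreducible, $\mathbf A$ has no proper subalgebras other than $\{0,1\}$, and $\mathbf A/\theta\cong\mathbf 2$ (the two-element Boolean algebra) for every proper nontrivial congruence $\theta$ of $\mathbf A$. An algebra $\mathbf A\in\mathsf{CIRL}$ is tight if $|A|>2$, $A$ has a least element $0$, and every element different from $0,1$ generates $\mathbf A$ (as an algebra in $\mathsf{CIRL}$). A variety is almost minimal if it covers an atom of the lattice of subvarieties. *)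

theory Defs
  imports "HOL.Hull" "HOL-Algebra.Group"
begin

section \<open>Commutative integral residuated lattices, with and without a least constant\<close>

text \<open>The multiplicative monoid is that of HOL-Algebra, so \<open>\<otimes>\<close> and \<open>\<one>\<close> are the monoid operations.\<close>

record 'a cirl_alg = "'a monoid" +
  vee :: "['a, 'a] \<Rightarrow> 'a" (infixl "\<curlyvee>\<index>" 65)
  wedge :: "['a, 'a] \<Rightarrow> 'a" (infixl "\<curlywedge>\<index>" 70)
  imp :: "['a, 'a] \<Rightarrow> 'a" (infixr "\<leadsto>\<index>" 60)

record 'a bcrl_alg = "'a cirl_alg" +
  zer :: 'a ("\<zero>\<index>")

definition leq :: "('a, 'm) cirl_alg_scheme \<Rightarrow> 'a \<Rightarrow> 'a \<Rightarrow> bool" (infix "\<preceq>\<index>" 50)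
  where "x \<preceq>\<^bsub>A\<^esub> y \<longleftrightarrow> x \<curlywedge>\<^bsub>A\<^esub> y = x"

locale cirl = comm_monoid A for A :: "('a, 'm) cirl_alg_scheme" (structure) +
  assumes vee_closed: "\<lbrakk>x \<in> carrier A; y \<in> carrier A\<rbrakk> \<Longrightarrow> x \<curlyvee> y \<in> carrier A"
    and wedge_closed: "\<lbrakk>x \<in> carrier A; y \<in> carrier A\<rbrakk> \<Longrightarrow> x \<curlywedge> y \<in> carrier A"
    and imp_closed: "\<lbrakk>x \<in> carrier A; y \<in> carrier A\<rbrakk> \<Longrightarrow> x \<leadsto> y \<in> carrier A"
    and vee_comm: "\<lbrakk>x \<in> carrier A; y \<in> carrier A\<rbrakk> \<Longrightarrow> x \<curlyvee> y = y \<curlyvee> x"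
    and wedge_comm: "\<lbrakk>x \<in> carrier A; y \<in> carrier A\<rbrakk> \<Longrightarrow> x \<curlywedge> y = y \<curlywedge> x"
    and vee_assoc: "\<lbrakk>x \<in> carrier A; y \<in> carrier A; z \<in> carrier A\<rbrakk>
          \<Longrightarrow> (x \<curlyvee> y) \<curlyvee> z = x \<curlyvee> (y \<curlyvee> z)"
    and wedge_assoc: "\<lbrakk>x \<in> carrier A; y \<in> carrier A; z \<in> carrier A\<rbrakk>
          \<Longrightarrow> (x \<curlywedge> y) \<curlywedge> z = x \<curlywedge> (y \<curlywedge> z)"
    and vee_absorb: "\<lbrakk>x \<in> carrier A; y \<in> carrier A\<rbrakk> \<Longrightarrow> x \<curlyvee> (x \<curlywedge> y) = x"
    and wedge_absorb: "\<lbrakk>x \<in> carrier A; y \<in> carrier A\<rbrakk> \<Longrightarrow> x \<curlywedge> (x \<curlyvee> y) = x"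
    and residuation: "\<lbrakk>x \<in> carrier A; y \<in> carrier A; z \<in> carrier A\<rbrakk>
          \<Longrightarrow> x \<otimes> y \<preceq> z \<longleftrightarrow> x \<preceq> y \<leadsto> z"
    and one_greatest: "x \<in> carrier A \<Longrightarrow> x \<preceq> \<one>"

locale bcrl = cirl A for A :: "('a, 'm) bcrl_alg_scheme" (structure) +
  assumes zer_closed: "\<zero> \<in> carrier A"
    and zer_least: "x \<in> carrier A \<Longrightarrow> \<zero> \<preceq> x"

definition zero_free_reduct :: "'a bcrl_alg \<Rightarrow> 'a cirl_alg"
  where "zero_free_reduct A = cirl_alg.truncate A"

definition two :: "bool bcrl_alg"
  where "two = \<lparr>carrier = UNIV, mult = (\<and>), one = True,
                vee = (\<or>), wedge = (\<and>), imp = (\<longrightarrow>), zer = False\<rparr>"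

text \<open>The cardinal inequality |X| > 2, for possibly infinite X.\<close>

definition more_than_two :: "'a set \<Rightarrow> bool"
  where "more_than_two X \<longleftrightarrow> infinite X \<or> 2 < card X"


section \<open>Subalgebras, congruences, quotients, isomorphisms\<close>

definition cirl_subuniverse :: "('a, 'm) cirl_alg_scheme \<Rightarrow> 'a set \<Rightarrow> bool"
  where "cirl_subuniverse A S \<longleftrightarrow> S \<subseteq> carrier A \<and> \<one>\<^bsub>A\<^esub> \<in> S \<and>
     (\<forall>x\<in>S. \<forall>y\<in>S. x \<otimes>\<^bsub>A\<^esub> y \<in> S \<and> x \<curlyvee>\<^bsub>A\<^esub> y \<in> S \<and> x \<curlywedge>\<^bsub>A\<^esub> y \<in> S \<and> x \<leadsto>\<^bsub>A\<^esub> y \<in> S)"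

definition bcrl_subuniverse :: "('a, 'm) bcrl_alg_scheme \<Rightarrow> 'a set \<Rightarrow> bool"
  where "bcrl_subuniverse A S \<longleftrightarrow> cirl_subuniverse A S \<and> \<zero>\<^bsub>A\<^esub> \<in> S"

text \<open>The nullary operations impose no condition on a congruence, so this notion serves for both
  signatures.\<close>

definition congruence :: "('a, 'm) cirl_alg_scheme \<Rightarrow> 'a rel \<Rightarrow> bool"
  where "congruence A \<theta> \<longleftrightarrow> equiv (carrier A) \<theta> \<and>
     (\<forall>(x, x') \<in> \<theta>. \<forall>(y, y') \<in> \<theta>.
        (x \<otimes>\<^bsub>A\<^esub> y, x' \<otimes>\<^bsub>A\<^esub> y') \<in> \<theta> \<and> (x \<curlyvee>\<^bsub>A\<^esub> y, x' \<curlyvee>\<^bsub>A\<^esub> y') \<in> \<theta> \<and>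
        (x \<curlywedge>\<^bsub>A\<^esub> y, x' \<curlywedge>\<^bsub>A\<^esub> y') \<in> \<theta> \<and> (x \<leadsto>\<^bsub>A\<^esub> y, x' \<leadsto>\<^bsub>A\<^esub> y') \<in> \<theta>)"

definition lift_op :: "'a rel \<Rightarrow> ('a \<Rightarrow> 'a \<Rightarrow> 'a) \<Rightarrow> 'a set \<Rightarrow> 'a set \<Rightarrow> 'a set"
  where "lift_op \<theta> f X Y = (\<Union>x\<in>X. \<Union>y\<in>Y. \<theta> `` {f x y})"

definition quotient_alg :: "'a bcrl_alg \<Rightarrow> 'a rel \<Rightarrow> 'a set bcrl_alg"
  where "quotient_alg A \<theta> = \<lparr>carrier = carrier A // \<theta>,
     mult = lift_op \<theta> (mult A), one = \<theta> `` {\<one>\<^bsub>A\<^esub>},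
     vee = lift_op \<theta> (vee A), wedge = lift_op \<theta> (wedge A), imp = lift_op \<theta> (imp A),
     zer = \<theta> `` {\<zero>\<^bsub>A\<^esub>}\<rparr>"

definition isomorphic :: "'a bcrl_alg \<Rightarrow> 'b bcrl_alg \<Rightarrow> bool"
  where "isomorphic A B \<longleftrightarrow> (\<exists>h. bij_betw h (carrier A) (carrier B) \<and>
     h \<one>\<^bsub>A\<^esub> = \<one>\<^bsub>B\<^esub> \<and> h \<zero>\<^bsub>A\<^esub> = \<zero>\<^bsub>B\<^esub> \<and>
     (\<forall>x\<in>carrier A. \<forall>y\<in>carrier A.
        h (x \<otimes>\<^bsub>A\<^esub> y) = h x \<otimes>\<^bsub>B\<^esub> h y \<and> h (x \<curlyvee>\<^bsub>A\<^esub> y) = h x \<curlyvee>\<^bsub>B\<^esub> h y \<and>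
        h (x \<curlywedge>\<^bsub>A\<^esub> y) = h x \<curlywedge>\<^bsub>B\<^esub> h y \<and> h (x \<leadsto>\<^bsub>A\<^esub> y) = h x \<leadsto>\<^bsub>B\<^esub> h y))"

text \<open>Existence of a monolith; in particular one-element algebras are not subdirectly
  irreducible.\<close>

definition subdirectly_irreducible :: "('a, 'm) cirl_alg_scheme \<Rightarrow> bool"
  where "subdirectly_irreducible A \<longleftrightarrow>
     (\<exists>\<mu>. congruence A \<mu> \<and> \<mu> \<noteq> Id_on (carrier A) \<and>
          (\<forall>\<theta>. congruence A \<theta> \<and> \<theta> \<noteq> Id_on (carrier A) \<longrightarrow> \<mu> \<subseteq> \<theta>))"


section \<open>Rigid and tight algebras\<close>

definition rigid :: "'a bcrl_alg \<Rightarrow> bool"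
  where "rigid A \<longleftrightarrow> bcrl A \<and> more_than_two (carrier A) \<and> subdirectly_irreducible A \<and>
     (\<forall>S. bcrl_subuniverse A S \<and> S \<noteq> carrier A \<longrightarrow> S = {\<zero>\<^bsub>A\<^esub>, \<one>\<^bsub>A\<^esub>}) \<and>
     (\<forall>\<theta>. congruence A \<theta> \<and> \<theta> \<noteq> carrier A \<times> carrier A \<and> \<theta> \<noteq> Id_on (carrier A)
        \<longrightarrow> isomorphic (quotient_alg A \<theta>) two)"

definition tight :: "'a cirl_alg \<Rightarrow> bool"
  where "tight A \<longleftrightarrow> cirl A \<and> more_than_two (carrier A) \<and>
     (\<exists>z\<in>carrier A. (\<forall>x\<in>carrier A. z \<preceq>\<^bsub>A\<^esub> x) \<and>
        (\<forall>a\<in>carrier A. a \<noteq> z \<and> a \<noteq> \<one>\<^bsub>A\<^esub> \<longrightarrow> cirl_subuniverse A hull {a} = carrier A))"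


section \<open>Varieties\<close>

datatype trm = Var nat | Vee trm trm | Wedge trm trm | Mult trm trm | Imp trm trm | One | Zer

primrec eval :: "'a bcrl_alg \<Rightarrow> (nat \<Rightarrow> 'a) \<Rightarrow> trm \<Rightarrow> 'a"
  where
    "eval A v (Var n) = v n"
  | "eval A v (Vee s t) = eval A v s \<curlyvee>\<^bsub>A\<^esub> eval A v t"
  | "eval A v (Wedge s t) = eval A v s \<curlywedge>\<^bsub>A\<^esub> eval A v t"
  | "eval A v (Mult s t) = eval A v s \<otimes>\<^bsub>A\<^esub> eval A v t"
  | "eval A v (Imp s t) = eval A v s \<leadsto>\<^bsub>A\<^esub> eval A v t"
  | "eval A v One = \<one>\<^bsub>A\<^esub>"
  | "eval A v Zer = \<zero>\<^bsub>A\<^esub>"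

definition satisfies :: "'a bcrl_alg \<Rightarrow> trm \<times> trm \<Rightarrow> bool"
  where "satisfies A e \<longleftrightarrow>
     (\<forall>v. range v \<subseteq> carrier A \<longrightarrow> eval A v (fst e) = eval A v (snd e))"

text \<open>An arbitrary algebra of the type of BCRL is a record whose carrier is closed under its
  operations. A variety is an equational class of such algebras.

  Classes of algebras have to live over a fixed type of potential elements, and for the lattice of
  varieties over \<open>'u\<close> to be the usual one \<open>'u\<close> must be infinite: the countably generated free
  algebras, which separate varieties, are countable and hence have copies with carrier in
  \<open>'u\<close>.\<close>

definition equational_class :: "(trm \<times> trm) set \<Rightarrow> 'u bcrl_alg set"
  where "equational_class E =
     {A. bcrl_subuniverse A (carrier A) \<and> (\<forall>e\<in>E. satisfies A e)}"

definition BCRL :: "'u bcrl_alg set"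
  where "BCRL = {A. bcrl A}"

definition BCRL_subvarieties :: "'u bcrl_alg set set"
  where "BCRL_subvarieties = {V \<in> range equational_class. V \<subseteq> BCRL}"

text \<open>The intersection of all varieties containing \<open>A\<close>. The two occurrences of
  \<open>equational_class E\<close> are at the types \<open>'a\<close> and \<open>'u\<close>, so that \<open>A\<close> need not have its elements in
  the universe \<open>'u\<close>; for \<open>'a = 'u\<close> this is the least variety with \<open>A\<close> as a member.\<close>

definition generated_variety :: "'a bcrl_alg \<Rightarrow> 'u bcrl_alg set"
  where "generated_variety A = \<Inter> {equational_class E | E. A \<in> equational_class E}"

definition covers :: "'b::order set \<Rightarrow> 'b \<Rightarrow> 'b \<Rightarrow> bool"
  where "covers L y x \<longleftrightarrow> x \<in> L \<and> y \<in> L \<and> x < y \<and> \<not> (\<exists>z\<in>L. x < z \<and> z < y)"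

definition atom_of :: "'b::order set \<Rightarrow> 'b \<Rightarrow> bool"
  where "atom_of L a \<longleftrightarrow> (\<exists>b\<in>L. (\<forall>z\<in>L. b \<le> z) \<and> covers L a b)"

definition almost_minimal :: "'u bcrl_alg set \<Rightarrow> bool"
  where "almost_minimal V \<longleftrightarrow>
     (\<exists>W. atom_of BCRL_subvarieties W \<and> covers BCRL_subvarieties V W)"

end

theory Submission
  imports Defs "HOL-Library.FuncSet"
begin

text \<open>A proper nontrivial congruence \<open>\<theta>\<close> has some \<open>c \<noteq> \<zero>, \<one>\<close> in the class of \<open>\<one>\<close>, so if \<open>{\<zero>, \<one>}\<close> is
  the only proper subalgebra, the subalgebra of all elements congruent to \<open>\<zero>\<close> or \<open>\<one>\<close> is everything:
  the condition on quotients in the definition of rigidity is automatic. A tight algebra is even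
  simple, because the class of \<open>\<one>\<close> is a subalgebra of the \<open>0\<close>-free reduct.

  The variety of Boolean algebras is the only atom. For a finite algebra, a set of terms closed under
  multiplication has a member with least values on finitely many valuations. This least term \<open>d\<close>
  replaces Jonsson's lemma: its values \<open>e\<close> are idempotent, and the filters above \<open>e\<close> provide the
  quotients. Applied to the terms that are \<open>\<one>\<close> at an enumeration of \<open>A\<close>, it shows that a finite
  subdirectly irreducible \<open>A\<close> is not in the variety of a smaller algebra, in particular of a proper
  subalgebra. Applied to the terms that are \<open>\<one>\<close> throughout a non-Boolean subvariety of a rigid
  \<open>A\<close>, it yields a valuation with \<open>e = \<one>\<close>, since \<open>e \<noteq> \<one>\<close> would give a quotient of \<open>A\<close> that
  violates a Boolean identity; that valuation generates \<open>A\<close>, so \<open>A\<close> lies in the subvariety.\<close>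


section \<open>Order and residuation\<close>

text \<open>By integrality this is \<open>\<one>\<close> exactly when \<open>x = y\<close>, so any
  equation can be traded for one whose right side is \<open>\<one>\<close>.\<close>

definition bicond :: "('a, 'm) cirl_alg_scheme \<Rightarrow> 'a \<Rightarrow> 'a \<Rightarrow> 'a"
  where "bicond A x y = (x \<leadsto>\<^bsub>A\<^esub> y) \<curlywedge>\<^bsub>A\<^esub> (y \<leadsto>\<^bsub>A\<^esub> x)"

context cirl
begin

lemmas closed = vee_closed wedge_closed imp_closed

lemma wedge_idem: "x \<in> carrier A \<Longrightarrow> x \<curlywedge> x = x"
  by (metis vee_absorb wedge_absorb wedge_closed)

lemma leq_refl: "x \<in> carrier A \<Longrightarrow> x \<preceq> x"
  by (simp add: leq_def wedge_idem)

lemma leq_antisym: "\<lbrakk>x \<preceq> y; y \<preceq> x; x \<in> carrier A; y \<in> carrier A\<rbrakk> \<Longrightarrow> x = y"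
  by (metis leq_def wedge_comm)

lemma leq_trans: "\<lbrakk>x \<preceq> y; y \<preceq> z; x \<in> carrier A; y \<in> carrier A; z \<in> carrier A\<rbrakk> \<Longrightarrow> x \<preceq> z"
  by (metis leq_def wedge_assoc)

lemma leq_iff_vee: "\<lbrakk>x \<in> carrier A; y \<in> carrier A\<rbrakk> \<Longrightarrow> x \<preceq> y \<longleftrightarrow> x \<curlyvee> y = y"
  by (metis leq_def wedge_comm vee_comm vee_absorb wedge_absorb)

lemma wedge_lower1: "\<lbrakk>x \<in> carrier A; y \<in> carrier A\<rbrakk> \<Longrightarrow> x \<curlywedge> y \<preceq> x"
  by (metis leq_def wedge_assoc wedge_comm wedge_idem)

lemma wedge_lower2: "\<lbrakk>x \<in> carrier A; y \<in> carrier A\<rbrakk> \<Longrightarrow> x \<curlywedge> y \<preceq> y"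
  by (metis wedge_comm wedge_lower1)

lemma wedge_greatest:
  "\<lbrakk>z \<preceq> x; z \<preceq> y; x \<in> carrier A; y \<in> carrier A; z \<in> carrier A\<rbrakk> \<Longrightarrow> z \<preceq> x \<curlywedge> y"
  by (metis leq_def wedge_assoc)

lemma vee_upper1: "\<lbrakk>x \<in> carrier A; y \<in> carrier A\<rbrakk> \<Longrightarrow> x \<preceq> x \<curlyvee> y"
  by (simp add: leq_def wedge_absorb)

lemma vee_upper2: "\<lbrakk>x \<in> carrier A; y \<in> carrier A\<rbrakk> \<Longrightarrow> y \<preceq> x \<curlyvee> y"
  by (metis vee_comm vee_upper1)

lemma vee_least:
  "\<lbrakk>x \<preceq> z; y \<preceq> z; x \<in> carrier A; y \<in> carrier A; z \<in> carrier A\<rbrakk> \<Longrightarrow> x \<curlyvee> y \<preceq> z"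
  by (simp add: leq_iff_vee vee_assoc vee_closed)

lemma one_leq_iff: "x \<in> carrier A \<Longrightarrow> \<one> \<preceq> x \<longleftrightarrow> x = \<one>"
  using leq_antisym leq_refl one_greatest by blast

lemma wedge_eq_one_iff: "\<lbrakk>x \<in> carrier A; y \<in> carrier A\<rbrakk> \<Longrightarrow> x \<curlywedge> y = \<one> \<longleftrightarrow> x = \<one> \<and> y = \<one>"
  by (metis one_leq_iff wedge_lower1 wedge_lower2 wedge_idem)

lemma mult_mono_left:
  assumes "x \<preceq> y" "x \<in> carrier A" "y \<in> carrier A" "z \<in> carrier A"
  shows "x \<otimes> z \<preceq> y \<otimes> z"
proof -
  have "y \<preceq> z \<leadsto> (y \<otimes> z)"
    using assms residuation[of y z "y \<otimes> z"] leq_refl by simp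
  then have "x \<preceq> z \<leadsto> (y \<otimes> z)"
    using assms leq_trans imp_closed by blast
  then show ?thesis
    using assms residuation by simp
qed

lemma mult_mono:
  assumes "x \<preceq> x'" "y \<preceq> y'" "x \<in> carrier A" "x' \<in> carrier A" "y \<in> carrier A" "y' \<in> carrier A"
  shows "x \<otimes> y \<preceq> x' \<otimes> y'"
proof -
  have "x \<otimes> y \<preceq> x' \<otimes> y"
    using assms mult_mono_left by blast
  moreover have "y \<otimes> x' \<preceq> y' \<otimes> x'"
    using assms mult_mono_left by blast
  ultimately show ?thesis
    using assms by (metis leq_trans m_comm m_closed)
qed

lemma mult_lower1: "\<lbrakk>x \<in> carrier A; y \<in> carrier A\<rbrakk> \<Longrightarrow> x \<otimes> y \<preceq> x"
  using mult_mono[OF leq_refl one_greatest, of x y] by simp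

lemma mult_lower2: "\<lbrakk>x \<in> carrier A; y \<in> carrier A\<rbrakk> \<Longrightarrow> x \<otimes> y \<preceq> y"
  by (metis m_comm mult_lower1)

lemma modus_ponens: "\<lbrakk>x \<in> carrier A; y \<in> carrier A\<rbrakk> \<Longrightarrow> (x \<leadsto> y) \<otimes> x \<preceq> y"
  by (simp add: residuation leq_refl imp_closed)

lemma imp_eq_one_iff: "\<lbrakk>x \<in> carrier A; y \<in> carrier A\<rbrakk> \<Longrightarrow> x \<leadsto> y = \<one> \<longleftrightarrow> x \<preceq> y"
  using residuation[of \<one> x y] one_leq_iff[of "x \<leadsto> y"] by (simp add: imp_closed)

lemma one_imp: "x \<in> carrier A \<Longrightarrow> \<one> \<leadsto> x = x"
  by (metis imp_closed leq_antisym leq_refl modus_ponens one_closed r_one residuation)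

lemma imp_self: "x \<in> carrier A \<Longrightarrow> x \<leadsto> x = \<one>"
  by (simp add: imp_eq_one_iff leq_refl)

text \<open>Multiplication by \<open>z\<close> is a lower adjoint: the hypotheses put
  \<open>x\<close> and \<open>y\<close>, hence their join, below
  \<open>z \<leadsto> w\<close>.\<close>

lemma mult_vee_leq:
  assumes "z \<otimes> x \<preceq> w" "z \<otimes> y \<preceq> w"
    and "x \<in> carrier A" "y \<in> carrier A" "z \<in> carrier A" "w \<in> carrier A"
  shows "z \<otimes> (x \<curlyvee> y) \<preceq> w"
proof -
  have "x \<preceq> z \<leadsto> w" "y \<preceq> z \<leadsto> w"
    using assms residuation by (simp_all add: m_comm)
  then have "x \<curlyvee> y \<preceq> z \<leadsto> w"
    using assms vee_least imp_closed by simp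
  then show ?thesis
    using assms residuation[of "x \<curlyvee> y" z w] by (simp add: m_comm vee_closed)
qed

lemma bicond_closed: "\<lbrakk>x \<in> carrier A; y \<in> carrier A\<rbrakk> \<Longrightarrow> bicond A x y \<in> carrier A"
  by (simp add: bicond_def closed)

lemma bicond_eq_one_iff: "\<lbrakk>x \<in> carrier A; y \<in> carrier A\<rbrakk> \<Longrightarrow> bicond A x y = \<one> \<longleftrightarrow> x = y"
  unfolding bicond_def
  by (metis imp_closed imp_eq_one_iff leq_antisym leq_refl wedge_eq_one_iff)

end


section \<open>Filters and congruences\<close>

text \<open>Upward closed submonoids; each is the class of \<open>\<one>\<close> under the
  congruence \<open>filter_cong A F\<close>.\<close>

definition deductive_filter :: "('a, 'm) cirl_alg_scheme \<Rightarrow> 'a set \<Rightarrow> bool"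
  where "deductive_filter A F \<longleftrightarrow> F \<subseteq> carrier A \<and> \<one>\<^bsub>A\<^esub> \<in> F \<and>
     (\<forall>x\<in>F. \<forall>y\<in>F. x \<otimes>\<^bsub>A\<^esub> y \<in> F) \<and> (\<forall>x\<in>F. \<forall>y\<in>carrier A. x \<preceq>\<^bsub>A\<^esub> y \<longrightarrow> y \<in> F)"

definition filter_cong :: "('a, 'm) cirl_alg_scheme \<Rightarrow> 'a set \<Rightarrow> 'a rel"
  where "filter_cong A F =
     {(x, y) \<in> carrier A \<times> carrier A. (x \<leadsto>\<^bsub>A\<^esub> y) \<in> F \<and> (y \<leadsto>\<^bsub>A\<^esub> x) \<in> F}"

context cirl
begin

text \<open>The implication itself is a witness by modus ponens, and any witness lies below it by
  residuation. In the witness form, compatibility and transitivity follow by multiplying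
  witnesses.\<close>

lemma filter_imp_iff:
  assumes "deductive_filter A F" "x \<in> carrier A" "y \<in> carrier A"
  shows "(x \<leadsto> y) \<in> F \<longleftrightarrow> (\<exists>f\<in>F. f \<otimes> x \<preceq> y)"
proof
  assume "(x \<leadsto> y) \<in> F"
  then show "\<exists>f\<in>F. f \<otimes> x \<preceq> y"
    using modus_ponens[of x y] assms by blast
next
  assume "\<exists>f\<in>F. f \<otimes> x \<preceq> y"
  then obtain f where "f \<in> F" "f \<otimes> x \<preceq> y" by blast
  moreover from this have "f \<in> carrier A"
    using assms unfolding deductive_filter_def by blast
  ultimately have "f \<preceq> x \<leadsto> y"
    using assms residuation by simp
  then show "(x \<leadsto> y) \<in> F"
    using assms \<open>f \<in> F\<close> imp_closed[of x y] unfolding deductive_filter_def by simp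
qed

text \<open>The product \<open>f \<otimes> g\<close> of the two witnesses serves for all four
  operations. Implication is antitone on the left, whence the exchange of \<open>x\<close> and
  \<open>x'\<close> in the last conclusion.\<close>

lemma filter_imp_ops:
  assumes F: "deductive_filter A F"
    and car: "x \<in> carrier A" "x' \<in> carrier A" "y \<in> carrier A" "y' \<in> carrier A"
    and x: "(x \<leadsto> x') \<in> F" and y: "(y \<leadsto> y') \<in> F"
  shows "(x \<otimes> y \<leadsto> x' \<otimes> y') \<in> F" "(x \<curlyvee> y \<leadsto> x' \<curlyvee> y') \<in> F"
    "(x \<curlywedge> y \<leadsto> x' \<curlywedge> y') \<in> F" "((x' \<leadsto> y) \<leadsto> (x \<leadsto> y')) \<in> F"
proof -
  obtain f where f: "f \<in> F" "f \<otimes> x \<preceq> x'"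
    using filter_imp_iff[OF F] x car by meson
  obtain g where g: "g \<in> F" "g \<otimes> y \<preceq> y'"
    using filter_imp_iff[OF F] y car by meson
  have fg: "f \<otimes> g \<in> F" and fc: "f \<in> carrier A" and gc: "g \<in> carrier A"
    using F f g unfolding deductive_filter_def by auto
  note car = car fc gc
  have fx: "f \<otimes> g \<otimes> z \<preceq> x'" if "z \<preceq> x" "z \<in> carrier A" for z
    by (rule leq_trans[OF mult_mono[of "f \<otimes> g" f z x] f(2)])
      (use that car mult_lower1 in simp_all)
  have gy: "f \<otimes> g \<otimes> z \<preceq> y'" if "z \<preceq> y" "z \<in> carrier A" for z
    by (rule leq_trans[OF mult_mono[of "f \<otimes> g" g z y] g(2)])
      (use that car mult_lower2 in simp_all)
  have "(f \<otimes> g) \<otimes> (x \<otimes> y) = (f \<otimes> x) \<otimes> (g \<otimes> y)"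
    using car by (simp add: m_ac)
  then have "(f \<otimes> g) \<otimes> (x \<otimes> y) \<preceq> x' \<otimes> y'"
    using mult_mono[OF f(2) g(2)] car by simp
  then show "(x \<otimes> y \<leadsto> x' \<otimes> y') \<in> F"
    using filter_imp_iff[OF F] car fg m_closed by meson
  have "(f \<otimes> g) \<otimes> (x \<curlyvee> y) \<preceq> x' \<curlyvee> y'"
  proof (rule mult_vee_leq)
    show "f \<otimes> g \<otimes> x \<preceq> x' \<curlyvee> y'"
      using fx[of x] car leq_refl vee_upper1 leq_trans vee_closed m_closed by meson
    show "f \<otimes> g \<otimes> y \<preceq> x' \<curlyvee> y'"
      using gy[of y] car leq_refl vee_upper2 leq_trans vee_closed m_closed by meson
  qed (use car vee_closed in simp_all)
  then show "(x \<curlyvee> y \<leadsto> x' \<curlyvee> y') \<in> F"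
    using filter_imp_iff[OF F] car fg vee_closed by meson
  have "(f \<otimes> g) \<otimes> (x \<curlywedge> y) \<preceq> x' \<curlywedge> y'"
    using fx gy wedge_lower1 wedge_lower2 wedge_greatest car wedge_closed by simp
  then show "(x \<curlywedge> y \<leadsto> x' \<curlywedge> y') \<in> F"
    using filter_imp_iff[OF F] car fg wedge_closed by meson
  \<comment> \<open>Regrouped so that \<open>f\<close> carries \<open>x\<close> to
    \<open>x'\<close>, modus ponens gives \<open>y\<close>, and \<open>g\<close> carries
    \<open>y\<close> to \<open>y'\<close>.\<close>
  have "((f \<otimes> g) \<otimes> (x' \<leadsto> y)) \<otimes> x = g \<otimes> ((x' \<leadsto> y) \<otimes> (f \<otimes> x))"
    using car imp_closed by (simp add: m_ac)
  moreover have "(x' \<leadsto> y) \<otimes> (f \<otimes> x) \<preceq> y"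
    by (rule leq_trans[OF mult_mono[OF leq_refl f(2)] modus_ponens])
      (use car imp_closed in simp_all)
  then have "g \<otimes> ((x' \<leadsto> y) \<otimes> (f \<otimes> x)) \<preceq> y'"
    by (rule leq_trans[OF mult_mono[OF leq_refl] g(2), rotated]) (use car imp_closed in simp_all)
  ultimately have "(f \<otimes> g) \<otimes> (x' \<leadsto> y) \<preceq> x \<leadsto> y'"
    using residuation[of "(f \<otimes> g) \<otimes> (x' \<leadsto> y)" x y'] car imp_closed by simp
  then show "((x' \<leadsto> y) \<leadsto> (x \<leadsto> y')) \<in> F"
    using filter_imp_iff[OF F] car fg imp_closed by meson
qed

lemma congruence_filter_cong:
  assumes F: "deductive_filter A F"
  shows "congruence A (filter_cong A F)"
proof -
  \<comment> \<open>Transitivity: the product of the witnesses is a witness for the composite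
    implication.\<close>
  have "(x \<leadsto> z) \<in> F" if xyz: "(x \<leadsto> y) \<in> F" "(y \<leadsto> z) \<in> F"
    "x \<in> carrier A" "y \<in> carrier A" "z \<in> carrier A" for x y z
  proof -
    have fc: "F \<subseteq> carrier A" using F unfolding deductive_filter_def by blast
    obtain f where f: "f \<in> F" "f \<otimes> x \<preceq> y"
      using filter_imp_iff[OF F] xyz by meson
    obtain g where g: "g \<in> F" "g \<otimes> y \<preceq> z"
      using filter_imp_iff[OF F] xyz by meson
    have fgc: "f \<in> carrier A" "g \<in> carrier A"
      using fc f g by auto
    have "g \<otimes> (f \<otimes> x) \<preceq> z"
      by (rule leq_trans[OF mult_mono[OF leq_refl f(2)] g(2)]) (use that fgc in simp_all)
    then have "(g \<otimes> f) \<otimes> x \<preceq> z"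
      using that fgc by (simp add: m_assoc)
    moreover have "g \<otimes> f \<in> F"
      using F f g unfolding deductive_filter_def by blast
    ultimately show ?thesis
      using filter_imp_iff[OF F] that by meson
  qed
  moreover have "\<one> \<in> F" using F unfolding deductive_filter_def by blast
  ultimately have "equiv (carrier A) (filter_cong A F)"
    unfolding equiv_def refl_on_def sym_def trans_def filter_cong_def
    by (auto simp: imp_self)
  then show ?thesis
    unfolding congruence_def
    by (auto simp: filter_cong_def filter_imp_ops[OF F] closed)
qed

text \<open>Of the two implications, \<open>x \<leadsto> \<one>\<close> is \<open>\<one>\<close> and
  \<open>\<one> \<leadsto> x\<close> is \<open>x\<close>.\<close>

lemma filter_cong_one_iff:
  assumes "deductive_filter A F" "x \<in> carrier A"
  shows "(x, \<one>) \<in> filter_cong A F \<longleftrightarrow> x \<in> F"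
  using assms imp_eq_one_iff[of x \<one>] one_greatest[of x]
  unfolding filter_cong_def deductive_filter_def by (auto simp: one_imp)

lemma congruence_sym: "congruence A \<theta> \<Longrightarrow> (x, y) \<in> \<theta> \<Longrightarrow> (y, x) \<in> \<theta>"
  by (meson congruence_def equivE symE)

lemma congruence_trans: "congruence A \<theta> \<Longrightarrow> (x, y) \<in> \<theta> \<Longrightarrow> (y, z) \<in> \<theta> \<Longrightarrow> (x, z) \<in> \<theta>"
  by (meson congruence_def equivE transE)

lemma congruence_refl: "congruence A \<theta> \<Longrightarrow> x \<in> carrier A \<Longrightarrow> (x, x) \<in> \<theta>"
  by (meson congruence_def equivE refl_onD)

lemma congruence_carrier:
  "congruence A \<theta> \<Longrightarrow> (x, y) \<in> \<theta> \<Longrightarrow> x \<in> carrier A \<and> y \<in> carrier A"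
  unfolding congruence_def equiv_def by auto

lemma congruence_ops:
  assumes "congruence A \<theta>" "(x, x') \<in> \<theta>" "(y, y') \<in> \<theta>"
  shows "(x \<otimes> y, x' \<otimes> y') \<in> \<theta>" "(x \<curlyvee> y, x' \<curlyvee> y') \<in> \<theta>"
    "(x \<curlywedge> y, x' \<curlywedge> y') \<in> \<theta>" "(x \<leadsto> y, x' \<leadsto> y') \<in> \<theta>"
  using assms unfolding congruence_def by blast+

lemma congruence_eq_iff:
  assumes "congruence A \<theta>" "(x, x') \<in> \<theta>" "(y, y') \<in> \<theta>"
  shows "(x, y) \<in> \<theta> \<longleftrightarrow> (x', y') \<in> \<theta>"
  using assms congruence_sym congruence_trans by blast

lemma congruence_bicond:
  assumes th: "congruence A \<theta>" and xy: "(x, y) \<in> \<theta>"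
  shows "(bicond A x y, \<one>) \<in> \<theta>"
proof -
  have car: "x \<in> carrier A" "y \<in> carrier A" using congruence_carrier th xy by auto
  have "(x \<leadsto> y, y \<leadsto> y) \<in> \<theta>" "(y \<leadsto> x, y \<leadsto> y) \<in> \<theta>"
    using congruence_ops(4)[OF th] congruence_refl[OF th] xy congruence_sym[OF th xy] car
    by blast+
  from congruence_ops(3)[OF th this] show ?thesis
    using car by (simp add: bicond_def imp_self wedge_idem)
qed

text \<open>The biconditional of two distinct congruent elements is congruent to
  \<open>\<one>\<close> without being equal to it.\<close>

lemma congruence_nontrivial_one_class:
  assumes th: "congruence A \<theta>" and nt: "\<theta> \<noteq> Id_on (carrier A)"
  obtains c where "(c, \<one>) \<in> \<theta>" "c \<in> carrier A" "c \<noteq> \<one>"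
proof -
  have "Id_on (carrier A) \<subseteq> \<theta>"
    using congruence_refl[OF th] by auto
  then obtain x y where xy: "(x, y) \<in> \<theta>" "x \<noteq> y"
    using nt congruence_carrier[OF th] by (metis Id_onI subsetI subset_antisym surj_pair)
  then have "(bicond A x y, \<one>) \<in> \<theta>" "bicond A x y \<in> carrier A" "bicond A x y \<noteq> \<one>"
    using th congruence_bicond congruence_carrier bicond_closed bicond_eq_one_iff by blast+
  then show thesis using that by blast
qed

text \<open>Take \<open>c \<noteq> \<one>\<close> in the class of \<open>\<one>\<close> under the
  monolith: a filter other than \<open>{\<one>}\<close> induces a nontrivial congruence, which
  contains the monolith.\<close>

lemma subdirectly_irreducible_filter_element:
  assumes "subdirectly_irreducible A"
  obtains c where "c \<in> carrier A" "c \<noteq> \<one>"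
    "\<And>F. deductive_filter A F \<Longrightarrow> F \<noteq> {\<one>} \<Longrightarrow> c \<in> F"
proof -
  obtain \<mu> where \<mu>: "congruence A \<mu>" "\<mu> \<noteq> Id_on (carrier A)"
    "\<And>\<theta>. congruence A \<theta> \<Longrightarrow> \<theta> \<noteq> Id_on (carrier A) \<Longrightarrow> \<mu> \<subseteq> \<theta>"
    using assms unfolding subdirectly_irreducible_def by blast
  obtain c where c: "(c, \<one>) \<in> \<mu>" "c \<in> carrier A" "c \<noteq> \<one>"
    using congruence_nontrivial_one_class[OF \<mu>(1,2)] by blast
  have "c \<in> F" if F: "deductive_filter A F" "F \<noteq> {\<one>}" for F
  proof -
    obtain f where "f \<in> F" "f \<noteq> \<one>" "f \<in> carrier A"
      using F unfolding deductive_filter_def by blast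
    then have "(f, \<one>) \<in> filter_cong A F"
      using F filter_cong_one_iff by blast
    then have "filter_cong A F \<noteq> Id_on (carrier A)"
      using \<open>f \<noteq> \<one>\<close> by auto
    then have "(c, \<one>) \<in> filter_cong A F"
      using \<mu>(3) congruence_filter_cong F c(1) by blast
    then show ?thesis
      using filter_cong_one_iff F c by blast
  qed
  then show thesis using that c by blast
qed

text \<open>As \<open>e \<otimes> e \<preceq> e\<close> always holds, \<open>e\<close> is
  idempotent; this makes its principal up-set closed under multiplication.\<close>

lemma deductive_filter_upset:
  assumes "e \<in> carrier A" "e \<preceq> e \<otimes> e"
  shows "deductive_filter A {x \<in> carrier A. e \<preceq> x}"
proof -
  have "e \<preceq> x \<otimes> y" if "e \<preceq> x" "e \<preceq> y" "x \<in> carrier A" "y \<in> carrier A" for x y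
    using leq_trans[OF assms(2) mult_mono] that assms(1) by simp
  moreover have "e \<preceq> y" if "e \<preceq> x" "x \<preceq> y" "x \<in> carrier A" "y \<in> carrier A" for x y
    using leq_trans that assms(1) by blast
  ultimately show ?thesis
    unfolding deductive_filter_def using assms(1) one_greatest by blast
qed

text \<open>Every operation returns \<open>\<one>\<close> at arguments \<open>\<one>\<close>, so it
  maps the class of \<open>\<one>\<close> into itself.\<close>

lemma cirl_subuniverse_one_class:
  assumes th: "congruence A \<theta>"
  shows "cirl_subuniverse A {x \<in> carrier A. (x, \<one>) \<in> \<theta>}"
    (is "cirl_subuniverse A ?T")
proof -
  have ones: "\<one> \<otimes> \<one> = \<one>" "\<one> \<curlyvee> \<one> = \<one>" "\<one> \<curlywedge> \<one> = \<one>" "\<one> \<leadsto> \<one> = \<one>"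
    using leq_iff_vee[of \<one> \<one>] leq_refl[of \<one>] by (auto simp: wedge_idem imp_self)
  have "x \<otimes> y \<in> ?T \<and> x \<curlyvee> y \<in> ?T \<and> x \<curlywedge> y \<in> ?T \<and> x \<leadsto> y \<in> ?T"
    if xy: "x \<in> ?T" "y \<in> ?T" for x y
    using congruence_ops[OF th, of x \<one> y \<one>] xy closed m_closed by (simp add: ones)
  then show ?thesis
    unfolding cirl_subuniverse_def using congruence_refl[OF th, of \<one>] by auto
qed

end


section \<open>Zero and one\<close>

context bcrl
begin

lemma zero_one_ops:
  "\<zero> \<otimes> \<zero> = \<zero>" "\<zero> \<otimes> \<one> = \<zero>" "\<one> \<otimes> \<zero> = \<zero>" "\<one> \<otimes> \<one> = \<one>"
  "\<zero> \<curlyvee> \<zero> = \<zero>" "\<zero> \<curlyvee> \<one> = \<one>" "\<one> \<curlyvee> \<zero> = \<one>" "\<one> \<curlyvee> \<one> = \<one>"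
  "\<zero> \<curlywedge> \<zero> = \<zero>" "\<zero> \<curlywedge> \<one> = \<zero>" "\<one> \<curlywedge> \<zero> = \<zero>" "\<one> \<curlywedge> \<one> = \<one>"
  "\<zero> \<leadsto> \<zero> = \<one>" "\<zero> \<leadsto> \<one> = \<one>" "\<one> \<leadsto> \<zero> = \<zero>" "\<one> \<leadsto> \<one> = \<one>"
proof -
  have le: "\<zero> \<preceq> \<one>" "\<zero> \<preceq> \<zero>" "\<one> \<preceq> \<one>"
    using zer_closed leq_refl one_greatest by auto
  show "\<zero> \<otimes> \<zero> = \<zero>"
    using zer_closed leq_antisym mult_lower1 zer_least by simp
  show "\<zero> \<otimes> \<one> = \<zero>" "\<one> \<otimes> \<zero> = \<zero>" "\<one> \<otimes> \<one> = \<one>"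
    using zer_closed by auto
  show "\<zero> \<curlyvee> \<zero> = \<zero>" "\<zero> \<curlyvee> \<one> = \<one>" "\<one> \<curlyvee> \<one> = \<one>"
    using le zer_closed by (auto simp: leq_iff_vee)
  then show "\<one> \<curlyvee> \<zero> = \<one>" using vee_comm zer_closed by simp
  show "\<zero> \<curlywedge> \<zero> = \<zero>" "\<zero> \<curlywedge> \<one> = \<zero>" "\<one> \<curlywedge> \<one> = \<one>"
    using le by (auto simp: leq_def)
  then show "\<one> \<curlywedge> \<zero> = \<zero>" using wedge_comm zer_closed by simp
  show "\<zero> \<leadsto> \<zero> = \<one>" "\<zero> \<leadsto> \<one> = \<one>" "\<one> \<leadsto> \<zero> = \<zero>" "\<one> \<leadsto> \<one> = \<one>"
    using le zer_closed by (auto simp: imp_eq_one_iff one_imp)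
qed

lemma zero_neq_one_iff: "\<zero> = \<one> \<longleftrightarrow> carrier A = {\<one>}"
proof
  assume "\<zero> = \<one>"
  then show "carrier A = {\<one>}"
    using zer_least one_leq_iff by auto
next
  assume "carrier A = {\<one>}"
  then show "\<zero> = \<one>" using zer_closed by blast
qed

lemma bcrl_subuniverse_carrier: "bcrl_subuniverse A (carrier A)"
  unfolding bcrl_subuniverse_def cirl_subuniverse_def using closed zer_closed by auto

text \<open>The preimage of the subalgebra of the quotient that consists of the classes of
  \<open>\<zero>\<close> and \<open>\<one>\<close>.\<close>

lemma bcrl_subuniverse_zero_one_classes:
  assumes th: "congruence A \<theta>"
  shows "bcrl_subuniverse A {x \<in> carrier A. (x, \<zero>) \<in> \<theta> \<or> (x, \<one>) \<in> \<theta>}"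
    (is "bcrl_subuniverse A ?T")
proof -
  have refl: "(\<one>, \<one>) \<in> \<theta>" "(\<zero>, \<zero>) \<in> \<theta>"
    using congruence_refl[OF th] zer_closed by auto
  have "x \<otimes> y \<in> ?T \<and> x \<curlyvee> y \<in> ?T \<and> x \<curlywedge> y \<in> ?T \<and> x \<leadsto> y \<in> ?T"
    if xy: "x \<in> ?T" "y \<in> ?T" for x y
  proof -
    obtain a b where "(x, a) \<in> \<theta>" "(y, b) \<in> \<theta>" "a \<in> {\<zero>, \<one>}" "b \<in> {\<zero>, \<one>}"
      using xy by blast
    with congruence_ops[OF th this(1,2)] show ?thesis
      using xy closed m_closed by (auto simp: zero_one_ops)
  qed
  then show ?thesis
    unfolding bcrl_subuniverse_def cirl_subuniverse_def using refl zer_closed by auto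
qed

text \<open>Joining both sides of the pair with \<open>x\<close> makes \<open>x\<close> congruent to
  \<open>\<one>\<close>.\<close>

lemma congruence_full:
  assumes th: "congruence A \<theta>" and z: "(\<zero>, \<one>) \<in> \<theta>"
  shows "\<theta> = carrier A \<times> carrier A"
proof -
  have "(x, \<one>) \<in> \<theta>" if x: "x \<in> carrier A" for x
  proof -
    have "(\<zero> \<curlyvee> x, \<one> \<curlyvee> x) \<in> \<theta>"
      using congruence_ops(2)[OF th z congruence_refl[OF th x]] .
    moreover have "\<zero> \<curlyvee> x = x"
      using x leq_iff_vee zer_least zer_closed by simp
    moreover have "\<one> \<curlyvee> x = \<one>"
      using x leq_iff_vee one_greatest vee_comm one_closed by metis
    ultimately show ?thesis by simp
  qed
  then show ?thesis
    using congruence_sym[OF th] congruence_trans[OF th] congruence_carrier[OF th] by fast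
qed

text \<open>Both \<open>a\<close> and \<open>a \<leadsto> \<zero>\<close> are idempotent, so their
  up-sets are filters. If neither element were \<open>\<one>\<close>, both filters would contain
  \<open>c\<close>, and the join \<open>\<one>\<close> would lie below \<open>c\<close>.\<close>

lemma complement_trivial:
  assumes si: "subdirectly_irreducible A" and a: "a \<in> carrier A" "a \<curlyvee> (a \<leadsto> \<zero>) = \<one>"
  shows "a = \<zero> \<or> a = \<one>"
proof -
  let ?b = "a \<leadsto> \<zero>"
  have b: "?b \<in> carrier A" using a imp_closed zer_closed by blast
  obtain c where c: "c \<in> carrier A" "c \<noteq> \<one>"
    "\<And>F. deductive_filter A F \<Longrightarrow> F \<noteq> {\<one>} \<Longrightarrow> c \<in> F"
    using subdirectly_irreducible_filter_element[OF si] by blast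
  have ba: "?b \<otimes> a \<preceq> \<zero>" using modus_ponens a zer_closed by simp
  \<comment> \<open>Idempotency: \<open>x = x \<otimes> (x \<curlyvee> y)\<close>, and
    \<open>x \<otimes> x\<close> bounds both \<open>x \<otimes> x\<close> and
    \<open>x \<otimes> y\<close>, the latter being below \<open>\<zero>\<close>.\<close>
  have le: "x \<preceq> z" if "x \<otimes> y \<preceq> \<zero>" "z \<in> carrier A" "x \<in> carrier A" "y \<in> carrier A" "z = x \<otimes> x" "x \<curlyvee> y = \<one>"
    for x y z
  proof -
    have "x \<otimes> y \<preceq> z" using that leq_trans[OF that(1) zer_least] zer_closed by simp
    then have "x \<otimes> (x \<curlyvee> y) \<preceq> z" using that leq_refl[of z] mult_vee_leq[of x x z y] by simp
    then show ?thesis using that by simp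
  qed
  have aa: "a \<preceq> a \<otimes> a"
    by (rule le[of a ?b]) (use a b ba in \<open>simp_all add: m_comm\<close>)
  have bb: "?b \<preceq> ?b \<otimes> ?b"
    by (rule le[of ?b a]) (use a b ba vee_comm in simp_all)
  have "a = \<one> \<or> a \<preceq> c"
    using c(3)[OF deductive_filter_upset[OF a(1) aa]] a leq_refl by blast
  moreover have "?b = \<one> \<or> ?b \<preceq> c"
    using c(3)[OF deductive_filter_upset[OF b bb]] b leq_refl by blast
  moreover have "\<not> (a \<preceq> c \<and> ?b \<preceq> c)"
    using vee_least a b c one_leq_iff by metis
  moreover have "a = \<zero>" if "?b = \<one>"
    using that ba a zer_closed zer_least leq_antisym by simp
  ultimately show ?thesis by blast
qed

end


section \<open>Homomorphisms and terms\<close>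

definition alg_hom :: "'a bcrl_alg \<Rightarrow> 'b bcrl_alg \<Rightarrow> ('a \<Rightarrow> 'b) \<Rightarrow> bool"
  where "alg_hom A B h \<longleftrightarrow> h ` carrier A \<subseteq> carrier B \<and>
     h \<one>\<^bsub>A\<^esub> = \<one>\<^bsub>B\<^esub> \<and> h \<zero>\<^bsub>A\<^esub> = \<zero>\<^bsub>B\<^esub> \<and>
     (\<forall>x\<in>carrier A. \<forall>y\<in>carrier A.
        h (x \<otimes>\<^bsub>A\<^esub> y) = h x \<otimes>\<^bsub>B\<^esub> h y \<and> h (x \<curlyvee>\<^bsub>A\<^esub> y) = h x \<curlyvee>\<^bsub>B\<^esub> h y \<and>
        h (x \<curlywedge>\<^bsub>A\<^esub> y) = h x \<curlywedge>\<^bsub>B\<^esub> h y \<and> h (x \<leadsto>\<^bsub>A\<^esub> y) = h x \<leadsto>\<^bsub>B\<^esub> h y)"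

primrec subst :: "(nat \<Rightarrow> trm) \<Rightarrow> trm \<Rightarrow> trm"
  where
    "subst \<sigma> (Var n) = \<sigma> n"
  | "subst \<sigma> (Vee s t) = Vee (subst \<sigma> s) (subst \<sigma> t)"
  | "subst \<sigma> (Wedge s t) = Wedge (subst \<sigma> s) (subst \<sigma> t)"
  | "subst \<sigma> (Mult s t) = Mult (subst \<sigma> s) (subst \<sigma> t)"
  | "subst \<sigma> (Imp s t) = Imp (subst \<sigma> s) (subst \<sigma> t)"
  | "subst \<sigma> One = One"
  | "subst \<sigma> Zer = Zer"

definition Bicond :: "trm \<Rightarrow> trm \<Rightarrow> trm"
  where "Bicond s t = Wedge (Imp s t) (Imp t s)"

lemma eval_Bicond: "eval A v (Bicond s t) = bicond A (eval A v s) (eval A v t)"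
  by (simp add: Bicond_def bicond_def)

lemma eval_subst: "eval A v (subst \<sigma> t) = eval A (\<lambda>i. eval A v (\<sigma> i)) t"
  by (induction t) auto

lemma eval_in_subuniverse:
  assumes "bcrl_subuniverse A S" "range v \<subseteq> S"
  shows "eval A v t \<in> S"
  using assms(1) range_subsetD[OF assms(2)]
  by (induction t) (simp_all add: bcrl_subuniverse_def cirl_subuniverse_def)

text \<open>The term values form the subalgebra generated by \<open>range v\<close>, since terms can
  be combined by every operation.\<close>

lemma bcrl_subuniverse_term_values:
  assumes "bcrl_subuniverse A (carrier A)" "range v \<subseteq> carrier A"
  shows "bcrl_subuniverse A (range (eval A v))"
proof -
  have "\<exists>r. eval A v s \<otimes>\<^bsub>A\<^esub> eval A v t = eval A v r" for s t
    by (rule exI[of _ "Mult s t"]) simp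
  moreover have "\<exists>r. eval A v s \<curlyvee>\<^bsub>A\<^esub> eval A v t = eval A v r" for s t
    by (rule exI[of _ "Vee s t"]) simp
  moreover have "\<exists>r. eval A v s \<curlywedge>\<^bsub>A\<^esub> eval A v t = eval A v r" for s t
    by (rule exI[of _ "Wedge s t"]) simp
  moreover have "\<exists>r. eval A v s \<leadsto>\<^bsub>A\<^esub> eval A v t = eval A v r" for s t
    by (rule exI[of _ "Imp s t"]) simp
  moreover have "\<exists>r. \<one>\<^bsub>A\<^esub> = eval A v r"
    by (rule exI[of _ One]) simp
  moreover have "\<exists>r. \<zero>\<^bsub>A\<^esub> = eval A v r"
    by (rule exI[of _ Zer]) simp
  ultimately show ?thesis
    unfolding bcrl_subuniverse_def cirl_subuniverse_def
    using eval_in_subuniverse[OF assms] by (auto simp: image_iff)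
qed

text \<open>Allows later variables to be replaced by \<open>One\<close>, which leaves finitely many
  valuations in a finite algebra.\<close>

lemma eval_depends_on_finitely_many:
  "\<exists>k. \<forall>v w. (\<forall>i<k. v i = w i) \<longrightarrow> eval A v t = eval A w t"
proof (induction t)
  case (Var n)
  show ?case by (rule exI[of _ "Suc n"]) simp
next
  case (Vee s t)
  then obtain k l where "\<forall>v w. (\<forall>i<k. v i = w i) \<longrightarrow> eval A v s = eval A w s"
    "\<forall>v w. (\<forall>i<l. v i = w i) \<longrightarrow> eval A v t = eval A w t" by blast
  then show ?case by (intro exI[of _ "max k l"]) (metis eval.simps(2) less_max_iff_disj)
next
  case (Wedge s t)
  then obtain k l where "\<forall>v w. (\<forall>i<k. v i = w i) \<longrightarrow> eval A v s = eval A w s"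
    "\<forall>v w. (\<forall>i<l. v i = w i) \<longrightarrow> eval A v t = eval A w t" by blast
  then show ?case by (intro exI[of _ "max k l"]) (metis eval.simps(3) less_max_iff_disj)
next
  case (Mult s t)
  then obtain k l where "\<forall>v w. (\<forall>i<k. v i = w i) \<longrightarrow> eval A v s = eval A w s"
    "\<forall>v w. (\<forall>i<l. v i = w i) \<longrightarrow> eval A v t = eval A w t" by blast
  then show ?case by (intro exI[of _ "max k l"]) (metis eval.simps(4) less_max_iff_disj)
next
  case (Imp s t)
  then obtain k l where "\<forall>v w. (\<forall>i<k. v i = w i) \<longrightarrow> eval A v s = eval A w s"
    "\<forall>v w. (\<forall>i<l. v i = w i) \<longrightarrow> eval A v t = eval A w t" by blast
  then show ?case by (intro exI[of _ "max k l"]) (metis eval.simps(5) less_max_iff_disj)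
qed auto

section \<open>Preservation of identities under embeddings, images and subalgebras\<close>

lemma eval_hom:
  assumes A: "bcrl_subuniverse A (carrier A)" and h: "alg_hom A B h" and v: "range v \<subseteq> carrier A"
  shows "h (eval A v t) = eval B (\<lambda>i. h (v i)) t"
  by (induction t) (use h eval_in_subuniverse[OF A v] in \<open>simp_all add: alg_hom_def\<close>)

lemma satisfies_embedding:
  assumes A: "bcrl_subuniverse A (carrier A)" and h: "alg_hom A B h" "inj_on h (carrier A)"
    and e: "satisfies B e"
  shows "satisfies A e"
  unfolding satisfies_def
proof (intro allI impI)
  fix v :: "nat \<Rightarrow> 'a" assume v: "range v \<subseteq> carrier A"
  then have "range (\<lambda>i. h (v i)) \<subseteq> carrier B"
    using h(1) unfolding alg_hom_def by blast
  then have "h (eval A v (fst e)) = h (eval A v (snd e))"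
    using e unfolding satisfies_def eval_hom[OF A h(1) v] by blast
  then show "eval A v (fst e) = eval A v (snd e)"
    using h(2) eval_in_subuniverse[OF A v] inj_onD by metis
qed

lemma satisfies_image:
  assumes A: "bcrl_subuniverse A (carrier A)" and h: "alg_hom A B h" "h ` carrier A = carrier B"
    and e: "satisfies A e"
  shows "satisfies B e"
  unfolding satisfies_def
proof (intro allI impI)
  fix v :: "nat \<Rightarrow> 'b" assume v: "range v \<subseteq> carrier B"
  define w where "w i = inv_into (carrier A) h (v i)" for i
  have "v i \<in> h ` carrier A" for i using v h(2) by blast
  then have w: "range w \<subseteq> carrier A" and hw: "(\<lambda>i. h (w i)) = v"
    unfolding w_def using inv_into_into[of _ h "carrier A"] f_inv_into_f[of _ h "carrier A"] by auto
  have "eval A w (fst e) = eval A w (snd e)"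
    using e w unfolding satisfies_def by blast
  then show "eval B v (fst e) = eval B v (snd e)"
    using eval_hom[OF A h(1) w] hw by metis
qed

lemma eval_subalgebra: "eval (A\<lparr>carrier := S\<rparr>) v t = eval A v t"
  by (induction t) auto

lemma bcrl_subalgebra:
  fixes A :: "('a, 'm) bcrl_alg_scheme" (structure)
  assumes "bcrl A" and S: "bcrl_subuniverse A S"
  shows "bcrl (A\<lparr>carrier := S\<rparr>)"
proof -
  interpret bcrl A by fact
  have sub: "x \<in> carrier A" if "x \<in> S" for x
    using that S unfolding bcrl_subuniverse_def cirl_subuniverse_def by blast
  have leq: "x \<preceq>\<^bsub>A\<lparr>carrier := S\<rparr>\<^esub> y \<longleftrightarrow> x \<preceq> y" for x y
    by (simp add: leq_def)
  show ?thesis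
    using S unfolding bcrl_subuniverse_def cirl_subuniverse_def
    by unfold_locales
      (simp_all add: leq sub m_assoc vee_assoc wedge_assoc vee_absorb wedge_absorb residuation
        one_greatest zer_least, (meson sub m_comm vee_comm wedge_comm)+)
qed

section \<open>The two-element Boolean algebra\<close>

lemma bcrl_two: "bcrl two"
  by unfold_locales (auto simp: two_def leq_def)

lemma alg_hom_two:
  fixes A :: "'a bcrl_alg" (structure)
  assumes "bcrl A"
  shows "alg_hom two A (\<lambda>b. if b then \<one>\<^bsub>A\<^esub> else \<zero>\<^bsub>A\<^esub>)"
proof -
  interpret bcrl A by fact
  show ?thesis unfolding alg_hom_def two_def using zer_closed by (auto simp: zero_one_ops)
qed

text \<open>\<open>two\<close> embeds in every nontrivial algebra through \<open>\<zero>\<close> and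
  \<open>\<one>\<close>.\<close>

lemma satisfies_two:
  fixes A :: "'a bcrl_alg" (structure)
  assumes "bcrl A" "\<zero>\<^bsub>A\<^esub> \<noteq> \<one>\<^bsub>A\<^esub>" "satisfies A e"
  shows "satisfies two e"
proof (rule satisfies_embedding[OF _ alg_hom_two])
  show "bcrl_subuniverse two (carrier two)"
    using bcrl.bcrl_subuniverse_carrier[OF bcrl_two] .
qed (use assms in \<open>auto simp: inj_on_def\<close>)


section \<open>Two-element quotients\<close>

lemma alg_hom_to_two:
  fixes A :: "'a bcrl_alg" (structure)
  assumes "bcrl A" and th: "congruence A \<theta>" and proper: "(\<zero>\<^bsub>A\<^esub>, \<one>\<^bsub>A\<^esub>) \<notin> \<theta>"
    and all: "\<And>x. x \<in> carrier A \<Longrightarrow> (x, \<zero>\<^bsub>A\<^esub>) \<in> \<theta> \<or> (x, \<one>\<^bsub>A\<^esub>) \<in> \<theta>"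
  shows "alg_hom A two (\<lambda>x. (x, \<one>\<^bsub>A\<^esub>) \<in> \<theta>)"
proof -
  interpret bcrl A by fact
  have refl: "(\<one>, \<one>) \<in> \<theta>"
    using congruence_refl[OF th] by simp
  have ne: "\<zero> \<noteq> \<one>" using refl proper by metis
  \<comment> \<open>The truth value of \<open>x\<close> is read off a representative in
    \<open>{\<zero>, \<one>}\<close>, so the tables \<open>zero_one_ops\<close> decide all
    operations.\<close>
  have cls: "(x, \<one>) \<in> \<theta> \<longleftrightarrow> a = \<one>" if "(x, a) \<in> \<theta>" "a \<in> {\<zero>, \<one>}" for x a
    using that congruence_eq_iff[OF th that(1) refl] refl proper by auto
  have "((x \<otimes> y, \<one>) \<in> \<theta> \<longleftrightarrow> (x, \<one>) \<in> \<theta> \<and> (y, \<one>) \<in> \<theta>) \<and>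
      ((x \<curlyvee> y, \<one>) \<in> \<theta> \<longleftrightarrow> (x, \<one>) \<in> \<theta> \<or> (y, \<one>) \<in> \<theta>) \<and>
      ((x \<curlywedge> y, \<one>) \<in> \<theta> \<longleftrightarrow> (x, \<one>) \<in> \<theta> \<and> (y, \<one>) \<in> \<theta>) \<and>
      ((x \<leadsto> y, \<one>) \<in> \<theta> \<longleftrightarrow> ((x, \<one>) \<in> \<theta> \<longrightarrow> (y, \<one>) \<in> \<theta>))"
    if xy: "x \<in> carrier A" "y \<in> carrier A" for x y
  proof -
    obtain a b where ab: "(x, a) \<in> \<theta>" "(y, b) \<in> \<theta>" "a \<in> {\<zero>, \<one>}" "b \<in> {\<zero>, \<one>}"
      using all xy by blast
    have ops: "a \<otimes> b \<in> {\<zero>, \<one>}" "a \<curlyvee> b \<in> {\<zero>, \<one>}" "a \<curlywedge> b \<in> {\<zero>, \<one>}" "a \<leadsto> b \<in> {\<zero>, \<one>}"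
      using ab(3,4) by (auto simp: zero_one_ops)
    from ab(3,4) show ?thesis
      unfolding cls[OF ab(1,3)] cls[OF ab(2,4)] cls[OF congruence_ops(1)[OF th ab(1,2)] ops(1)]
        cls[OF congruence_ops(2)[OF th ab(1,2)] ops(2)]
        cls[OF congruence_ops(3)[OF th ab(1,2)] ops(3)]
        cls[OF congruence_ops(4)[OF th ab(1,2)] ops(4)]
      using ne by (elim insertE emptyE) (simp_all add: zero_one_ops)
  qed
  then show ?thesis
    unfolding alg_hom_def two_def using refl proper by simp
qed

text \<open>Compatibility of \<open>f\<close> makes all the sets in the union equal to one and the
  same class.\<close>

lemma lift_op_classes:
  assumes th: "equiv C \<theta>" and x: "x \<in> C" and y: "y \<in> C"
    and f: "\<And>x x' y y'. (x, x') \<in> \<theta> \<Longrightarrow> (y, y') \<in> \<theta> \<Longrightarrow> (f x y, f x' y') \<in> \<theta>"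
  shows "lift_op \<theta> f (\<theta> `` {x}) (\<theta> `` {y}) = \<theta> `` {f x y}"
proof -
  have "congruent2 \<theta> \<theta> (\<lambda>x y. \<theta> `` {f x y})"
    by (rule congruent2I') (rule equiv_class_eq[OF th f])
  from UN_equiv_class2[OF th th this x y] show ?thesis
    unfolding lift_op_def .
qed

lemma quotient_isomorphic_two:
  fixes A :: "'a bcrl_alg" (structure)
  assumes "bcrl A" and th: "congruence A \<theta>" and proper: "(\<zero>\<^bsub>A\<^esub>, \<one>\<^bsub>A\<^esub>) \<notin> \<theta>"
    and all: "\<And>x. x \<in> carrier A \<Longrightarrow> (x, \<zero>\<^bsub>A\<^esub>) \<in> \<theta> \<or> (x, \<one>\<^bsub>A\<^esub>) \<in> \<theta>"
  shows "isomorphic (quotient_alg A \<theta>) two"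
proof -
  interpret bcrl A by fact
  have eq: "equiv (carrier A) \<theta>" using th congruence_def by blast
  \<comment> \<open>Only the class of \<open>\<one>\<close> contains \<open>\<one>\<close>, so this
    map is the quotient form of the homomorphism \<open>hom\<close>.\<close>
  let ?h = "\<lambda>X. \<one> \<in> X"
  have hom: "alg_hom A two (\<lambda>x. (x, \<one>) \<in> \<theta>)"
    using alg_hom_to_two[OF assms] .
  have "\<theta> `` {x} \<in> {\<theta> `` {\<zero>}, \<theta> `` {\<one>}}" if "x \<in> carrier A" for x
    using all[OF that] equiv_class_eq[OF eq, of x] by blast
  then have "carrier A // \<theta> \<subseteq> {\<theta> `` {\<zero>}, \<theta> `` {\<one>}}"
    unfolding quotient_def by blast
  moreover have "\<theta> `` {\<zero>} \<in> carrier A // \<theta>" "\<theta> `` {\<one>} \<in> carrier A // \<theta>"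
    by (simp_all add: quotientI zer_closed)
  ultimately have "carrier A // \<theta> = {\<theta> `` {\<zero>}, \<theta> `` {\<one>}}"
    by blast
  then have "bij_betw ?h (carrier A // \<theta>) UNIV"
    using proper congruence_refl[OF th, of \<one>] unfolding bij_betw_def inj_on_def UNIV_bool by auto
  \<comment> \<open>Stated for an arbitrary operation \<open>f\<close> and truth function
    \<open>g\<close>, to be used for the four operations in turn.\<close>
  moreover have "?h (lift_op \<theta> f X Y) = g (?h X) (?h Y)"
    if "X \<in> carrier A // \<theta>" "Y \<in> carrier A // \<theta>"
      and f: "\<And>x x' y y'. (x, x') \<in> \<theta> \<Longrightarrow> (y, y') \<in> \<theta> \<Longrightarrow> (f x y, f x' y') \<in> \<theta>"
      and g: "\<And>x y. x \<in> carrier A \<Longrightarrow> y \<in> carrier A \<Longrightarrow>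
        ((f x y, \<one>) \<in> \<theta>) = g ((x, \<one>) \<in> \<theta>) ((y, \<one>) \<in> \<theta>)" for X Y f g
  proof -
    obtain x y where xy: "x \<in> carrier A" "y \<in> carrier A" "X = \<theta> `` {x}" "Y = \<theta> `` {y}"
      using \<open>X \<in> _\<close> \<open>Y \<in> _\<close> by (auto elim!: quotientE)
    show ?thesis
      using lift_op_classes[OF eq xy(1,2) f] g[OF xy(1,2)] xy by simp
  qed
  ultimately show ?thesis
    unfolding isomorphic_def quotient_alg_def
    using hom congruence_ops[OF th] proper congruence_refl[OF th, of \<one>]
    by (intro exI[of _ ?h]) (simp add: two_def alg_hom_def)
qed

section \<open>A criterion for rigidity, and tight algebras\<close>

lemma rigidI:
  fixes A :: "'a bcrl_alg" (structure)
  assumes "bcrl A" and mt: "more_than_two (carrier A)" and si: "subdirectly_irreducible A"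
    and sub: "\<And>S. bcrl_subuniverse A S \<Longrightarrow> S \<noteq> carrier A \<Longrightarrow> S = {\<zero>\<^bsub>A\<^esub>, \<one>\<^bsub>A\<^esub>}"
  shows "rigid A"
proof -
  interpret bcrl A by fact
  have "isomorphic (quotient_alg A \<theta>) two"
    if th: "congruence A \<theta>" and proper: "\<theta> \<noteq> carrier A \<times> carrier A" and nt: "\<theta> \<noteq> Id_on (carrier A)" for \<theta>
  proof -
    obtain c where c: "(c, \<one>) \<in> \<theta>" "c \<in> carrier A" "c \<noteq> \<one>"
      using congruence_nontrivial_one_class[OF th nt] by blast
    have "(\<zero>, \<one>) \<notin> \<theta>"
      using congruence_full[OF th] proper by blast
    let ?T = "{x \<in> carrier A. (x, \<zero>) \<in> \<theta> \<or> (x, \<one>) \<in> \<theta>}"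
    have "c \<noteq> \<zero>" using c \<open>(\<zero>, \<one>) \<notin> \<theta>\<close> by blast
    \<comment> \<open>\<open>c\<close> lies in the subalgebra \<open>?T\<close> and is neither
      \<open>\<zero>\<close> nor \<open>\<one>\<close>.\<close>
    then have "?T = carrier A"
      using sub[OF bcrl_subuniverse_zero_one_classes[OF th]] c by blast
    then show ?thesis
      using quotient_isomorphic_two[OF \<open>bcrl A\<close> th \<open>(\<zero>, \<one>) \<notin> \<theta>\<close>] by blast
  qed
  then show ?thesis
    unfolding rigid_def using assms by blast
qed

lemma tight_imp_rigid:
  fixes A :: "'a bcrl_alg" (structure)
  assumes "bcrl A" and tight: "tight (zero_free_reduct A)"
  shows "rigid A"
proof -
  interpret bcrl A by fact
  have red: "carrier (zero_free_reduct A) = carrier A" "one (zero_free_reduct A) = \<one>"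
    "cirl_subuniverse (zero_free_reduct A) = cirl_subuniverse A"
    "leq (zero_free_reduct A) = leq A"
    unfolding zero_free_reduct_def cirl_alg.truncate_def cirl_subuniverse_def leq_def
    by (auto intro!: ext)
  obtain z where z: "z \<in> carrier A" "\<And>x. x \<in> carrier A \<Longrightarrow> z \<preceq> x"
    "\<And>a. \<lbrakk>a \<in> carrier A; a \<noteq> z; a \<noteq> \<one>\<rbrakk> \<Longrightarrow> cirl_subuniverse A hull {a} = carrier A"
    using tight unfolding tight_def red by blast
  have mt: "more_than_two (carrier A)" using tight unfolding tight_def red by blast
  \<comment> \<open>The bottom named by tightness is the constant, so no proper subalgebra of the
    reduct has an element outside \<open>{\<zero>, \<one>}\<close>.\<close>
  have "z = \<zero>" using z zer_least zer_closed leq_antisym by blast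
  then have gen: "S = carrier A" if "cirl_subuniverse A S" "a \<in> S" "a \<noteq> \<zero>" "a \<noteq> \<one>" for S a
    using that z(3)[of a] hull_minimal[of "{a}" S "cirl_subuniverse A"]
    unfolding cirl_subuniverse_def by blast
  have simple: "\<theta> = carrier A \<times> carrier A"
    if th: "congruence A \<theta>" and nt: "\<theta> \<noteq> Id_on (carrier A)" for \<theta>
  proof -
    obtain c where c: "(c, \<one>) \<in> \<theta>" "c \<in> carrier A" "c \<noteq> \<one>"
      using congruence_nontrivial_one_class[OF th nt] by blast
    \<comment> \<open>Either \<open>c\<close> is \<open>\<zero>\<close> already, or the class of
      \<open>\<one>\<close> is a subalgebra containing a generator, hence the whole algebra.\<close>
    have z1: "(\<zero>, \<one>) \<in> \<theta>"
      using gen[OF cirl_subuniverse_one_class[OF th], of c] c zer_closed by (cases "c = \<zero>") auto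
    then show ?thesis using congruence_full[OF th] by blast
  qed
  have zo: "\<zero> \<noteq> \<one>"
    using mt zero_neq_one_iff unfolding more_than_two_def by auto
  \<comment> \<open>By simplicity the full relation is the monolith, provided it differs from the
    identity.\<close>
  have "congruence A (carrier A \<times> carrier A)"
    unfolding congruence_def equiv_def refl_on_def sym_def trans_def using closed by auto
  moreover have "carrier A \<times> carrier A \<noteq> Id_on (carrier A)"
    using zo zer_closed one_closed by (auto simp: Id_on_def)
  ultimately have "subdirectly_irreducible A"
    unfolding subdirectly_irreducible_def using simple by (metis subset_refl)
  moreover have "S = {\<zero>, \<one>}" if S: "bcrl_subuniverse A S" "S \<noteq> carrier A" for S
    using S gen[of S] unfolding bcrl_subuniverse_def cirl_subuniverse_def by blast
  ultimately show ?thesis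
    using rigidI assms(1) mt by blast
qed


section \<open>Least terms\<close>

text \<open>Over a finite algebra there are only finitely many of these valuations, as
  \<open>least_term\<close> requires.\<close>

definition bounded_vals :: "'a bcrl_alg \<Rightarrow> nat \<Rightarrow> (nat \<Rightarrow> 'a) set"
  where "bounded_vals A k = {v. range v \<subseteq> carrier A \<and> (\<forall>i\<ge>k. v i = \<one>\<^bsub>A\<^esub>)}"

text \<open>The syntactic counterpart: evaluating a term after this substitution amounts to
  evaluating it at a valuation in \<open>bounded_vals A k\<close>.\<close>

definition truncate_subst :: "nat \<Rightarrow> nat \<Rightarrow> trm"
  where "truncate_subst k i = (if i < k then Var i else One)"

lemma finite_bounded_vals: "finite (carrier A) \<Longrightarrow> finite (bounded_vals A k)"
  by (rule finite_subset[OF _ finite_set_of_finite_funs[of "{..<k}" "carrier A" "\<one>\<^bsub>A\<^esub>"]])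
    (auto simp: bounded_vals_def)

lemma truncate_in_bounded_vals:
  assumes "bcrl A" "range v \<subseteq> carrier A"
  shows "(\<lambda>i. eval A v (truncate_subst k i)) \<in> bounded_vals A k"
proof -
  interpret bcrl A by fact
  show ?thesis
    using assms(2) by (auto simp: bounded_vals_def truncate_subst_def)
qed

text \<open>On the finite set \<open>W\<close> the terms in \<open>\<Theta>\<close> have only
  finitely many value tables. Multiplying one representative for each table gives a term in
  \<open>\<Theta>\<close> whose values lie below those of all factors by integrality.\<close>

lemma least_term:
  fixes A :: "'a bcrl_alg" (structure)
  assumes "bcrl A" and fin: "finite (carrier A)" "finite W"
    and W: "\<And>w. w \<in> W \<Longrightarrow> range w \<subseteq> carrier A"
    and One: "One \<in> \<Theta>" and Mult: "\<And>s t. s \<in> \<Theta> \<Longrightarrow> t \<in> \<Theta> \<Longrightarrow> Mult s t \<in> \<Theta>"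
  obtains d where "d \<in> \<Theta>" "\<And>t w. t \<in> \<Theta> \<Longrightarrow> w \<in> W \<Longrightarrow> eval A w d \<preceq> eval A w t"
proof -
  interpret bcrl A by fact
  have ev: "eval A w t \<in> carrier A" if "w \<in> W" for w t
    using eval_in_subuniverse bcrl_subuniverse_carrier W that by blast
  \<comment> \<open>The table of values of \<open>t\<close> on \<open>W\<close>, restricted so that
    tables form a finite function space.\<close>
  define R where "R t = (\<lambda>w\<in>W. eval A w t)" for t
  have "R ` \<Theta> \<subseteq> W \<rightarrow>\<^sub>E carrier A"
    using ev by (auto simp: R_def)
  then have "finite (R ` \<Theta>)"
    using fin by (meson finite_PiE finite_subset)
  then obtain \<Theta>' where \<Theta>': "\<Theta>' \<subseteq> \<Theta>" "finite \<Theta>'" "R ` \<Theta> = R ` \<Theta>'"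
    by (meson finite_subset_image subset_refl)
  have "\<exists>d\<in>\<Theta>. \<forall>t\<in>\<Theta>'. \<forall>w\<in>W. eval A w d \<preceq> eval A w t"
    using \<Theta>'(2,1)
  proof (induction \<Theta>')
    case empty
    then show ?case using One by blast
  next
    case (insert s \<Theta>')
    then obtain d where d: "d \<in> \<Theta>" "\<And>t w. t \<in> \<Theta>' \<Longrightarrow> w \<in> W \<Longrightarrow> eval A w d \<preceq> eval A w t"
      by blast
    have "eval A w (Mult s d) \<preceq> eval A w t" if "t \<in> insert s \<Theta>'" "w \<in> W" for t w
    proof (cases "t = s")
      case True
      then show ?thesis using mult_lower1 ev that by simp
    next
      case False
      have "eval A w s \<otimes> eval A w d \<preceq> eval A w d"
        using mult_lower2 ev that by simp
      moreover have "eval A w d \<preceq> eval A w t" using d False that by blast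
      ultimately show ?thesis
        using leq_trans ev that m_closed by simp
    qed
    moreover have "Mult s d \<in> \<Theta>" using Mult d insert.prems by blast
    ultimately show ?case by blast
  qed
  then obtain d where d: "d \<in> \<Theta>" "\<And>t w. t \<in> \<Theta>' \<Longrightarrow> w \<in> W \<Longrightarrow> eval A w d \<preceq> eval A w t"
    by blast
  have "eval A w d \<preceq> eval A w t" if "t \<in> \<Theta>" "w \<in> W" for t w
  proof -
    obtain t' where "t' \<in> \<Theta>'" "R t = R t'"
      using \<Theta>'(3) \<open>t \<in> \<Theta>\<close> by blast
    then have "eval A w t = eval A w t'"
      using \<open>w \<in> W\<close> unfolding R_def by (metis restrict_apply')
    then show ?thesis using d(2) \<open>t' \<in> \<Theta>'\<close> \<open>w \<in> W\<close> by simp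
  qed
  then show thesis using that d(1) by blast
qed

text \<open>A substitute for Jonsson's lemma: if \<open>A\<close> lies in the variety generated by \<open>S\<close>, then it embeds
  in a quotient of \<open>S\<close>.\<close>

lemma card_le_of_satisfies:
  fixes A :: "'a bcrl_alg" and S :: "'b bcrl_alg"
  assumes A: "bcrl A" "finite (carrier A)" "subdirectly_irreducible A"
    and S: "bcrl S" "finite (carrier S)"
    and eqs: "\<And>e. satisfies S e \<Longrightarrow> satisfies A e"
  shows "card (carrier A) \<le> card (carrier S)"
proof -
  interpret A: bcrl A by fact
  interpret S: bcrl S by fact
  obtain n and f :: "nat \<Rightarrow> 'a" where f: "carrier A = f ` {i. i < n}"
    using A(2) by (auto simp: finite_conv_nat_seg_image)
  \<comment> \<open>\<open>v\<close> enumerates the carrier on the first \<open>n\<close> variables;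
    with \<open>\<one>\<close> as default value, truncation at \<open>n\<close> leaves it
    unchanged.\<close>
  define v where "v i = (if i < n then f i else \<one>\<^bsub>A\<^esub>)" for i
  have v: "range v \<subseteq> carrier A"
    using f by (auto simp: v_def)
  have vtrunc: "(\<lambda>i. eval A v (truncate_subst n i)) = v"
    by (auto simp: v_def truncate_subst_def)
  have vsurj: "\<exists>i. v i = a" if "a \<in> carrier A" for a
    using that f by (auto simp: v_def)
  have evA: "eval A v t \<in> carrier A" for t
    using eval_in_subuniverse A.bcrl_subuniverse_carrier v by blast
  obtain c where c: "c \<in> carrier A" "c \<noteq> \<one>\<^bsub>A\<^esub>"
    "\<And>F. deductive_filter A F \<Longrightarrow> F \<noteq> {\<one>\<^bsub>A\<^esub>} \<Longrightarrow> c \<in> F"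
    using A.subdirectly_irreducible_filter_element[OF A(3)] by blast
  obtain j where j: "v j = c" using vsurj c by blast
  \<comment> \<open>The terms that must become trivial in a quotient of \<open>S\<close> if
    \<open>A\<close> is to embed in it; the value of \<open>d\<close> will generate the
    corresponding filter.\<close>
  define \<Theta> where "\<Theta> = {t. eval A v t = \<one>\<^bsub>A\<^esub>}"
  obtain d where d: "d \<in> \<Theta>"
    "\<And>t w. t \<in> \<Theta> \<Longrightarrow> w \<in> bounded_vals S n \<Longrightarrow> eval S w d \<preceq>\<^bsub>S\<^esub> eval S w t"
    by (rule least_term[OF S finite_bounded_vals[OF S(2), of n], of \<Theta>])
      (auto simp: bounded_vals_def \<Theta>_def)
  \<comment> \<open>Since \<open>d\<close> is \<open>\<one>\<close> at \<open>v\<close>, this term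
    takes the value \<open>\<one> \<leadsto> c = c\<close> there. So \<open>?t = One\<close> fails
    in \<open>A\<close>, hence also in \<open>S\<close>.\<close>
  let ?t = "subst (truncate_subst n) (Imp d (Var j))"
  have "eval A v ?t = c"
    using d(1) c(1) unfolding eval_subst vtrunc \<Theta>_def by (simp add: j A.one_imp)
  then have "\<not> satisfies A (?t, One)"
    using v c(2) unfolding satisfies_def by auto
  then obtain w' where w': "range w' \<subseteq> carrier S" "eval S w' ?t \<noteq> \<one>\<^bsub>S\<^esub>"
    using eqs[of "(?t, One)"] unfolding satisfies_def by auto
  \<comment> \<open>Truncation brings the refuting valuation into \<open>bounded_vals S n\<close>,
    where \<open>d\<close> is least.\<close>
  define w where "w i = eval S w' (truncate_subst n i)" for i
  have wb: "w \<in> bounded_vals S n"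
    unfolding w_def using truncate_in_bounded_vals[OF S(1) w'(1)] .
  then have w: "range w \<subseteq> carrier S" by (simp add: bounded_vals_def)
  have evS: "eval S w t \<in> carrier S" for t
    using eval_in_subuniverse S.bcrl_subuniverse_carrier w by blast
  define e where "e = eval S w d"
  have e: "e \<in> carrier S" using evS e_def by simp
  have "eval S w (Imp d (Var j)) \<noteq> \<one>\<^bsub>S\<^esub>"
    using w'(2) unfolding eval_subst w_def by simp
  then have ej: "\<not> e \<preceq>\<^bsub>S\<^esub> w j"
    using S.imp_eq_one_iff[OF e, of "w j"] w by (auto simp: e_def)
  have ele: "e \<preceq>\<^bsub>S\<^esub> eval S w t" if "eval A v t = \<one>\<^bsub>A\<^esub>" for t
    unfolding e_def using d(2) wb that by (simp add: \<Theta>_def)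
  have ee: "e \<preceq>\<^bsub>S\<^esub> e \<otimes>\<^bsub>S\<^esub> e"
    using ele[of "Mult d d"] d(1) by (simp add: \<Theta>_def e_def)
  \<comment> \<open>If the value of \<open>s\<close> is below that of \<open>t\<close> in
    \<open>A\<close>, then \<open>Imp s t\<close> is in \<open>\<Theta>\<close>; modus ponens costs
    one factor \<open>e\<close>, which idempotency restores.\<close>
  have mp: "e \<preceq>\<^bsub>S\<^esub> eval S w t" if "e \<preceq>\<^bsub>S\<^esub> eval S w s" "eval A v s \<preceq>\<^bsub>A\<^esub> eval A v t" for s t
  proof -
    have "e \<preceq>\<^bsub>S\<^esub> eval S w s \<leadsto>\<^bsub>S\<^esub> eval S w t"
      using ele[of "Imp s t"] that(2) A.imp_eq_one_iff evA by simp
    then have "e \<otimes>\<^bsub>S\<^esub> eval S w s \<preceq>\<^bsub>S\<^esub> eval S w t"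
      using S.residuation e evS by simp
    moreover have "e \<otimes>\<^bsub>S\<^esub> e \<preceq>\<^bsub>S\<^esub> e \<otimes>\<^bsub>S\<^esub> eval S w s"
      using S.mult_mono[OF S.leq_refl that(1)] e evS by simp
    ultimately show ?thesis
      using ee S.leq_trans e evS S.m_closed by meson
  qed
  \<comment> \<open>The trace in \<open>A\<close> of the filter above \<open>e\<close> in
    \<open>S\<close>. By \<open>mp\<close> the choice of a term for \<open>a\<close> does not
    matter.\<close>
  define F where "F = {a \<in> carrier A. \<exists>t. eval A v t = a \<and> e \<preceq>\<^bsub>S\<^esub> eval S w t}"
  have "x \<otimes>\<^bsub>A\<^esub> y \<in> F" if xy: "x \<in> F" "y \<in> F" for x y
  proof -
    obtain s t where st: "eval A v s = x" "e \<preceq>\<^bsub>S\<^esub> eval S w s" "eval A v t = y" "e \<preceq>\<^bsub>S\<^esub> eval S w t"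
      using xy F_def by blast
    have "e \<otimes>\<^bsub>S\<^esub> e \<preceq>\<^bsub>S\<^esub> eval S w s \<otimes>\<^bsub>S\<^esub> eval S w t"
      using S.mult_mono st e evS by simp
    then have "e \<preceq>\<^bsub>S\<^esub> eval S w (Mult s t)"
      using S.leq_trans[OF ee] e evS by simp
    moreover have "eval A v (Mult s t) = x \<otimes>\<^bsub>A\<^esub> y" using st by simp
    ultimately show ?thesis
      unfolding F_def using evA[of "Mult s t"] by (metis (mono_tags, lifting) mem_Collect_eq)
  qed
  moreover have "y \<in> F" if x: "x \<in> F" and y: "y \<in> carrier A" and xy: "x \<preceq>\<^bsub>A\<^esub> y" for x y
  proof -
    obtain s where s: "eval A v s = x" "e \<preceq>\<^bsub>S\<^esub> eval S w s" using x F_def by blast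
    obtain i where i: "v i = y" using vsurj y by blast
    then have "e \<preceq>\<^bsub>S\<^esub> eval S w (Var i)" using mp[OF s(2), of "Var i"] s(1) xy by simp
    moreover have "eval A v (Var i) = y" using i by simp
    ultimately show ?thesis unfolding F_def using y by blast
  qed
  moreover have "\<one>\<^bsub>A\<^esub> \<in> F"
    unfolding F_def using S.one_greatest e by (auto intro!: exI[of _ One])
  ultimately have "deductive_filter A F"
    unfolding deductive_filter_def by (auto simp: F_def)
  \<comment> \<open>Otherwise \<open>mp\<close> would give \<open>e\<close> below
    \<open>w j\<close>, against \<open>ej\<close>; the choice of \<open>c\<close> then forces
    \<open>F\<close> to be trivial.\<close>
  moreover have "c \<notin> F"
  proof
    assume "c \<in> F"
    then obtain s where "eval A v s = c" "e \<preceq>\<^bsub>S\<^esub> eval S w s" using F_def by blast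
    then show False using mp[of s "Var j"] ej j A.leq_refl c(1) by simp
  qed
  ultimately have F: "F = {\<one>\<^bsub>A\<^esub>}" using c(3) by blast
  \<comment> \<open>\<open>g\<close> names each element of \<open>A\<close> by a variable. If two
    names have equal values at \<open>w\<close>, their biconditional is \<open>\<one>\<close> in
    \<open>S\<close>, so its value in \<open>A\<close> lies in the trivial filter
    \<open>F\<close>.\<close>
  define g where "g a = (SOME i. v i = a)" for a
  have g: "v (g a) = a" if "a \<in> carrier A" for a
    unfolding g_def using vsurj[OF that] by (rule someI_ex)
  have "inj_on (\<lambda>a. w (g a)) (carrier A)"
  proof (rule inj_onI)
    fix a b assume ab: "a \<in> carrier A" "b \<in> carrier A" "w (g a) = w (g b)"
    let ?b = "Bicond (Var (g a)) (Var (g b))"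
    have "w (g b) \<in> carrier S" using w by blast
    then have "eval S w ?b = \<one>\<^bsub>S\<^esub>"
      unfolding eval_Bicond using ab(3) S.bicond_eq_one_iff by simp
    then have "e \<preceq>\<^bsub>S\<^esub> eval S w ?b" using S.one_greatest e by simp
    then have "eval A v ?b \<in> F" unfolding F_def using evA by blast
    then show "a = b"
      unfolding F eval_Bicond using A.bicond_eq_one_iff ab g by simp
  qed
  moreover have "(\<lambda>a. w (g a)) ` carrier A \<subseteq> carrier S" using w by blast
  ultimately show ?thesis using card_inj_on_le S(2) by blast
qed

text \<open>Used with \<open>V\<close> a subvariety of the variety of \<open>A\<close>, to show that
  \<open>A\<close> satisfies the identities of \<open>V\<close> and so belongs to it. The term
  \<open>r\<close> witnesses that \<open>V\<close> is not Boolean.\<close>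

lemma satisfies_of_nonboolean_class:
  fixes A :: "'a bcrl_alg" (structure) and V :: "'u bcrl_alg set"
  assumes A: "bcrl A" "finite (carrier A)"
    and sub: "\<And>S. bcrl_subuniverse A S \<Longrightarrow> S \<noteq> carrier A \<Longrightarrow> S = {\<zero>, \<one>}"
    and V: "\<And>B. B \<in> V \<Longrightarrow> bcrl B" "\<And>B e. B \<in> V \<Longrightarrow> satisfies A e \<Longrightarrow> satisfies B e"
    and r: "B \<in> V" "satisfies two (r, One)" "\<not> satisfies B (r, One)"
    and e: "\<And>B. B \<in> V \<Longrightarrow> satisfies B e"
  shows "satisfies A e"
proof -
  interpret bcrl A by fact
  interpret B: bcrl B using V r(1) by blast
  define \<Theta> where "\<Theta> = {t. \<forall>B\<in>V. satisfies B (t, One)}"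
  \<comment> \<open>Bounds the variables on which \<open>r\<close> depends in \<open>B\<close>, so
    truncation at \<open>k\<close> keeps the failure of \<open>r\<close> there.\<close>
  obtain k where k: "\<And>v w. (\<And>i. i < k \<Longrightarrow> v i = w i) \<Longrightarrow> eval B v r = eval B w r"
    using eval_depends_on_finitely_many[of B r] by blast
  have "Mult s t \<in> \<Theta>" if "s \<in> \<Theta>" "t \<in> \<Theta>" for s t
  proof -
    have "satisfies C (Mult s t, One)" if "C \<in> V" for C
    proof -
      interpret C: bcrl C using V that by blast
      show ?thesis
        using \<open>s \<in> \<Theta>\<close> \<open>t \<in> \<Theta>\<close> that unfolding \<Theta>_def satisfies_def by simp
    qed
    then show ?thesis unfolding \<Theta>_def by blast
  qed
  moreover have "One \<in> \<Theta>" by (simp add: \<Theta>_def satisfies_def)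
  ultimately obtain d where d: "d \<in> \<Theta>"
    "\<And>t w. t \<in> \<Theta> \<Longrightarrow> w \<in> bounded_vals A k \<Longrightarrow> eval A w d \<preceq> eval A w t"
    using least_term[OF A finite_bounded_vals[OF A(2), of k], of \<Theta>]
    by (metis (mono_tags, lifting) bounded_vals_def mem_Collect_eq)
  have "\<exists>w\<in>bounded_vals A k. \<not> eval A w d \<preceq> eval A w r"
  proof (rule ccontr)
    assume neg: "\<not> ?thesis"
    \<comment> \<open>If \<open>d\<close> were below \<open>r\<close> at all bounded valuations,
      \<open>?t = One\<close> would hold in \<open>A\<close> and so in \<open>B\<close>. As
      \<open>d\<close> is \<open>\<one>\<close> throughout \<open>B\<close>, \<open>r\<close> would
      be too.\<close>
    let ?t = "subst (truncate_subst k) (Imp d r)"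
    have "satisfies A (?t, One)"
      unfolding satisfies_def
    proof (intro allI impI)
      fix v :: "nat \<Rightarrow> 'a" assume v: "range v \<subseteq> carrier A"
      define w where "w i = eval A v (truncate_subst k i)" for i
      have wb: "w \<in> bounded_vals A k"
        unfolding w_def using truncate_in_bounded_vals[OF A(1) v] .
      then have "eval A w t \<in> carrier A" for t
        using eval_in_subuniverse[OF bcrl_subuniverse_carrier] by (simp add: bounded_vals_def)
      then have "eval A w (Imp d r) = \<one>"
        using neg wb imp_eq_one_iff by simp
      then show "eval A v (fst (?t, One)) = eval A v (snd (?t, One))"
        by (simp add: eval_subst w_def[abs_def])
    qed
    then have Bt: "satisfies B (?t, One)" using V r(1) by blast
    obtain v where v: "range v \<subseteq> carrier B" "eval B v r \<noteq> \<one>\<^bsub>B\<^esub>"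
      using r(3) unfolding satisfies_def by auto
    define w where "w i = eval B v (truncate_subst k i)" for i
    have w: "range w \<subseteq> carrier B"
      unfolding w_def using truncate_in_bounded_vals[OF V(1)[OF r(1)] v(1), of k]
      by (simp add: bounded_vals_def)
    have "eval B w r = eval B v r"
      by (rule k) (simp add: w_def truncate_subst_def)
    moreover have "eval B w d = \<one>\<^bsub>B\<^esub>"
      using d(1) r(1) w unfolding \<Theta>_def satisfies_def by simp
    moreover have "eval B w (Imp d r) = \<one>\<^bsub>B\<^esub>"
      using Bt v(1) unfolding satisfies_def by (simp add: eval_subst w_def[abs_def])
    moreover have "eval B w r \<in> carrier B"
      using eval_in_subuniverse[OF B.bcrl_subuniverse_carrier w] .
    ultimately show False using v(2) B.one_imp by simp
  qed
  then obtain w where wb: "w \<in> bounded_vals A k" and dr: "\<not> eval A w d \<preceq> eval A w r"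
    by blast
  then have w: "range w \<subseteq> carrier A" by (simp add: bounded_vals_def)
  have ev: "eval A w t \<in> carrier A" for t
    using eval_in_subuniverse[OF bcrl_subuniverse_carrier w] .
  show ?thesis
  proof (cases "eval A w d = \<one>")
    case True
    \<comment> \<open>At a valuation in \<open>{\<zero>, \<one>}\<close> the term \<open>r\<close>
      takes its value from \<open>two\<close>, namely \<open>\<one>\<close>, against
      \<open>dr\<close>. So \<open>w\<close> generates \<open>A\<close>.\<close>
    have "\<not> range w \<subseteq> {\<zero>, \<one>}"
    proof
      assume "range w \<subseteq> {\<zero>, \<one>}"
      then have "w i = \<zero> \<or> w i = \<one>" for i by blast
      then have "w = (\<lambda>i. if w i = \<one> then \<one> else \<zero>)" by metis
      then have "eval A w r = (if eval two (\<lambda>i. w i = \<one>) r then \<one> else \<zero>)"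
        using eval_hom[OF bcrl.bcrl_subuniverse_carrier[OF bcrl_two] alg_hom_two[OF A(1)],
            of "\<lambda>i. w i = \<one>" r] by (simp add: two_def)
      moreover have "eval two (\<lambda>i. w i = \<one>) r"
        using r(2) unfolding satisfies_def by (simp add: two_def)
      ultimately show False using dr one_greatest ev by simp
    qed
    moreover have "range w \<subseteq> range (eval A w)"
      by (metis eval.simps(1) rangeI image_subsetI)
    ultimately have gen: "range (eval A w) = carrier A"
      using sub[OF bcrl_subuniverse_term_values[OF bcrl_subuniverse_carrier w]] by blast
    obtain s t where st: "e = (s, t)" by fastforce
    have "eval A v s = eval A v t" if v: "range v \<subseteq> carrier A" for v
    proof -
      \<comment> \<open>Since \<open>w\<close> generates \<open>A\<close>, any valuation
        \<open>v\<close> is \<open>w\<close> after a substitution \<open>\<sigma>\<close>.\<close>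
      have "\<forall>i. \<exists>u. eval A w u = v i" using gen v by (metis imageE range_subsetD)
      then obtain \<sigma> where \<sigma>: "\<And>i. eval A w (\<sigma> i) = v i" by metis
      have "satisfies C (subst \<sigma> (Bicond s t), One)" if "C \<in> V" for C
        unfolding satisfies_def
      proof (intro allI impI)
        fix u :: "nat \<Rightarrow> 'u" assume u: "range u \<subseteq> carrier C"
        interpret C: bcrl C using V that by blast
        have evC: "range (\<lambda>i. eval C u (\<sigma> i)) \<subseteq> carrier C"
          using eval_in_subuniverse[OF C.bcrl_subuniverse_carrier u] by blast
        then show "eval C u (fst (subst \<sigma> (Bicond s t), One)) =
            eval C u (snd (subst \<sigma> (Bicond s t), One))"
          using e[OF that] eval_in_subuniverse[OF C.bcrl_subuniverse_carrier evC]
            C.bicond_eq_one_iff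
          unfolding satisfies_def st by (simp add: eval_subst eval_Bicond)
      qed
      \<comment> \<open>The substituted biconditional is \<open>\<one>\<close> throughout
        \<open>V\<close>, hence in \<open>\<Theta>\<close>; leastness of \<open>d\<close>, whose
        value is \<open>\<one>\<close> here, transfers it to \<open>A\<close>.\<close>
      then have "eval A w d \<preceq> eval A w (subst \<sigma> (Bicond s t))"
        using d(2) wb by (simp add: \<Theta>_def)
      then have "eval A w (subst \<sigma> (Bicond s t)) = \<one>"
        using True one_leq_iff ev by simp
      then show ?thesis
        using bicond_eq_one_iff eval_in_subuniverse[OF bcrl_subuniverse_carrier v]
        by (simp add: eval_subst \<sigma> eval_Bicond)
    qed
    then show ?thesis by (simp add: satisfies_def st)
  next
    case False
    \<comment> \<open>Remaining case, by contradiction: dividing by the filter above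
      \<open>?e\<close> maps \<open>A\<close> onto \<open>two\<close>, where \<open>r\<close> is
      true, so \<open>?e\<close> would lie below the value of \<open>r\<close>.\<close>
    let ?e = "eval A w d"
    define F where "F = {x \<in> carrier A. ?e \<preceq> x}"
    define \<theta> where "\<theta> = filter_cong A F"
    have "Mult d d \<in> \<Theta>" using \<open>\<And>t s. s \<in> \<Theta> \<Longrightarrow> t \<in> \<Theta> \<Longrightarrow> Mult s t \<in> \<Theta>\<close> d(1) by blast
    then have "?e \<preceq> ?e \<otimes> ?e" using d(2)[OF _ wb, of "Mult d d"] by simp
    then have F: "deductive_filter A F"
      unfolding F_def using deductive_filter_upset ev by blast
    have th: "congruence A \<theta>" unfolding \<theta>_def using congruence_filter_cong[OF F] .
    have th1: "(x, \<one>) \<in> \<theta> \<longleftrightarrow> ?e \<preceq> x" if "x \<in> carrier A" for x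
      unfolding \<theta>_def using filter_cong_one_iff[OF F that] that by (simp add: F_def)
    \<comment> \<open>From \<open>?e \<preceq> \<zero>\<close> it would follow that
      \<open>?e\<close> is below every value, against \<open>dr\<close>; so the congruence is
      proper.\<close>
    have e0: "\<not> ?e \<preceq> \<zero>"
      using dr leq_trans zer_least zer_closed ev by blast
    then have z: "(\<zero>, \<one>) \<notin> \<theta>" using th1 zer_closed by blast
    let ?T = "{x \<in> carrier A. (x, \<zero>) \<in> \<theta> \<or> (x, \<one>) \<in> \<theta>}"
    have "?e \<in> ?T" using th1 ev leq_refl by simp
    moreover have "?e \<noteq> \<zero>" using e0 leq_refl zer_closed by auto
    ultimately have "?T = carrier A"
      using sub[OF bcrl_subuniverse_zero_one_classes[OF th]] False by blast
    then have hom: "alg_hom A two (\<lambda>x. (x, \<one>) \<in> \<theta>)"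
      using alg_hom_to_two[OF A(1) th z] by blast
    have "eval two (\<lambda>i. (w i, \<one>) \<in> \<theta>) r"
      using r(2) unfolding satisfies_def by (simp add: two_def)
    then have "(eval A w r, \<one>) \<in> \<theta>"
      using eval_hom[OF bcrl_subuniverse_carrier hom w] by simp
    then show ?thesis using th1 ev dr by blast
  qed
qed


section \<open>Varieties\<close>

text \<open>Residuation is not an equation; it is replaced by monotonicity of multiplication, the counit
  \<open>(y \<leadsto> z) \<otimes> y \<preceq> z\<close> and the unit \<open>x \<preceq> y \<leadsto> (x \<otimes> y \<curlyvee> z)\<close>.\<close>

lemma bcrl_of_equations:
  fixes X :: "'a bcrl_alg" and B :: "'b bcrl_alg" (structure)
  assumes "bcrl X" and B: "bcrl_subuniverse B (carrier B)"
    and eqs: "\<And>e. satisfies X e \<Longrightarrow> satisfies B e"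
  shows "bcrl B"
proof -
  interpret X: bcrl X by fact
  \<comment> \<open>Three variables suffice for all the axioms; every index from 2 on receives
    \<open>z\<close>.\<close>
  define val :: "'b \<Rightarrow> 'b \<Rightarrow> 'b \<Rightarrow> nat \<Rightarrow> 'b"
    where "val x y z i = (if i = 0 then x else if i = 1 then y else z)" for x y z i
  have tr: "eval B (val x y z) s = eval B (val x y z) t"
    if "\<And>v. (\<And>i. v i \<in> carrier X) \<Longrightarrow> eval X v s = eval X v t"
      "x \<in> carrier B" "y \<in> carrier B" "z \<in> carrier B" for x y z s t
  proof -
    have "satisfies X (s, t)" using that(1) unfolding satisfies_def by auto
    moreover have "range (val x y z) \<subseteq> carrier B" using that(2-4) by (auto simp: val_def)
    ultimately show ?thesis using eqs[of "(s, t)"] unfolding satisfies_def by simp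
  qed
  have [simp]: "val x y z 0 = x" "val x y z (Suc 0) = y" "val x y z 2 = z" for x y z
    by (simp_all add: val_def)
  let ?x = "Var 0" and ?y = "Var (Suc 0)" and ?z = "Var 2"
  have clos: "\<one> \<in> carrier B" "\<zero> \<in> carrier B"
    "\<And>x y. x \<in> carrier B \<Longrightarrow> y \<in> carrier B \<Longrightarrow>
      x \<otimes> y \<in> carrier B \<and> x \<curlyvee> y \<in> carrier B \<and> x \<curlywedge> y \<in> carrier B \<and> x \<leadsto> y \<in> carrier B"
    using B unfolding bcrl_subuniverse_def cirl_subuniverse_def by blast+
  have mult: "x \<otimes> y \<otimes> z = x \<otimes> (y \<otimes> z)" "x \<otimes> y = y \<otimes> x" "\<one> \<otimes> x = x"
    if "x \<in> carrier B" "y \<in> carrier B" "z \<in> carrier B" for x y z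
    using tr[of "Mult (Mult ?x ?y) ?z" "Mult ?x (Mult ?y ?z)", OF _ that]
      tr[of "Mult ?x ?y" "Mult ?y ?x", OF _ that] tr[of "Mult One ?x" ?x, OF _ that]
    by (simp_all add: X.m_ac)
  have vee: "x \<curlyvee> y \<curlyvee> z = x \<curlyvee> (y \<curlyvee> z)" "x \<curlyvee> y = y \<curlyvee> x" "x \<curlyvee> (x \<curlywedge> y) = x"
    if "x \<in> carrier B" "y \<in> carrier B" "z \<in> carrier B" for x y z
    subgoal using tr[of "Vee (Vee ?x ?y) ?z" "Vee ?x (Vee ?y ?z)", OF _ that]
      by (simp add: X.vee_assoc)
    subgoal using tr[of "Vee ?x ?y" "Vee ?y ?x", OF _ that] by (simp add: X.vee_comm)
    subgoal using tr[of "Vee ?x (Wedge ?x ?y)" ?x, OF _ that] by (simp add: X.vee_absorb)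
    done
  have wedge: "x \<curlywedge> y \<curlywedge> z = x \<curlywedge> (y \<curlywedge> z)" "x \<curlywedge> y = y \<curlywedge> x" "x \<curlywedge> (x \<curlyvee> y) = x"
    if "x \<in> carrier B" "y \<in> carrier B" "z \<in> carrier B" for x y z
    subgoal using tr[of "Wedge (Wedge ?x ?y) ?z" "Wedge ?x (Wedge ?y ?z)", OF _ that]
      by (simp add: X.wedge_assoc)
    subgoal using tr[of "Wedge ?x ?y" "Wedge ?y ?x", OF _ that] by (simp add: X.wedge_comm)
    subgoal using tr[of "Wedge ?x (Vee ?x ?y)" ?x, OF _ that] by (simp add: X.wedge_absorb)
    done
  have bounds: "x \<preceq> \<one>" "\<zero> \<preceq> x" if "x \<in> carrier B" for x
    using tr[of "Wedge ?x One" ?x, OF _ that that that] tr[of "Wedge Zer ?x" Zer, OF _ that that that]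
      X.one_greatest X.zer_least by (simp_all add: leq_def)
  have trans: "x \<preceq> z" if "x \<preceq> y" "y \<preceq> z" "x \<in> carrier B" "y \<in> carrier B" "z \<in> carrier B"
    for x y z
    using that wedge(1) unfolding leq_def by metis
  \<comment> \<open>Monotonicity as an identity: \<open>x \<curlywedge> y\<close> ranges over the
    elements below \<open>y\<close>.\<close>
  have mono: "(x \<curlywedge> y) \<otimes> z \<preceq> y \<otimes> z"
    if "x \<in> carrier B" "y \<in> carrier B" "z \<in> carrier B" for x y z
    using tr[of "Wedge (Mult (Wedge ?x ?y) ?z) (Mult ?y ?z)" "Mult (Wedge ?x ?y) ?z", OF _ that]
      X.mult_mono_left X.wedge_lower2 X.wedge_closed by (simp add: leq_def)
  have counit: "(y \<leadsto> z) \<otimes> y \<preceq> z"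
    if "x \<in> carrier B" "y \<in> carrier B" "z \<in> carrier B" for x y z
    using tr[of "Wedge (Mult (Imp ?y ?z) ?y) ?z" "Mult (Imp ?y ?z) ?y", OF _ that]
      X.modus_ponens by (simp add: leq_def)
  have X_unit: "a \<preceq>\<^bsub>X\<^esub> b \<leadsto>\<^bsub>X\<^esub> (a \<otimes>\<^bsub>X\<^esub> b \<curlyvee>\<^bsub>X\<^esub> c)"
    if "a \<in> carrier X" "b \<in> carrier X" "c \<in> carrier X" for a b c
    using X.residuation[of a b "a \<otimes>\<^bsub>X\<^esub> b \<curlyvee>\<^bsub>X\<^esub> c"] that X.vee_upper1 X.vee_closed by simp
  have unit: "x \<preceq> y \<leadsto> (x \<otimes> y \<curlyvee> z)"
    if "x \<in> carrier B" "y \<in> carrier B" "z \<in> carrier B" for x y z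
    using tr[of "Wedge ?x (Imp ?y (Vee (Mult ?x ?y) ?z))" ?x, OF _ that]
      X_unit by (simp add: leq_def)
  have residuation: "x \<otimes> y \<preceq> z \<longleftrightarrow> x \<preceq> y \<leadsto> z" if xyz: "x \<in> carrier B" "y \<in> carrier B" "z \<in> carrier B"
    for x y z
  proof
    assume "x \<otimes> y \<preceq> z"
    \<comment> \<open>Under the assumption the join in the unit identity collapses to
      \<open>z\<close>.\<close>
    then have "x \<otimes> y \<curlyvee> z = z"
      using vee(2,3) wedge(2) xyz clos(3) unfolding leq_def by metis
    then show "x \<preceq> y \<leadsto> z" using unit[OF xyz] by simp
  next
    assume "x \<preceq> y \<leadsto> z"
    then have "x \<otimes> y \<preceq> (y \<leadsto> z) \<otimes> y"
      using mono[of x "y \<leadsto> z" y] xyz clos(3) unfolding leq_def by simp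
    then show "x \<otimes> y \<preceq> z"
      using trans counit[OF xyz] xyz clos(3) by meson
  qed
  have comm: "x \<otimes> y = y \<otimes> x" "x \<curlyvee> y = y \<curlyvee> x" "x \<curlywedge> y = y \<curlywedge> x"
    if "x \<in> carrier B" "y \<in> carrier B" for x y
    using mult(2) vee(2) wedge(2) that by blast+
  have units: "\<one> \<otimes> x = x" "x \<otimes> \<one> = x" if "x \<in> carrier B" for x
    using mult(3)[OF that that that] comm(1)[OF that clos(1)] by simp_all
  show ?thesis
    by unfold_locales
      (simp_all add: clos residuation bounds units mult(1) vee(1) wedge(1)
        vee(3)[OF _ _ clos(1)] wedge(3)[OF _ _ clos(1)], (rule comm; assumption)+)
qed

section \<open>Generated varieties and their comparison\<close>

lemma generated_variety_eq:
  assumes "bcrl X"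
  shows "generated_variety X = equational_class {e. satisfies X e}"
proof
  have "X \<in> equational_class {e. satisfies X e}"
    using bcrl.bcrl_subuniverse_carrier[OF assms] by (simp add: equational_class_def)
  then show "generated_variety X \<subseteq> equational_class {e. satisfies X e}"
    unfolding generated_variety_def by blast
  \<comment> \<open>Any \<open>E\<close> in the intersection consists of identities of
    \<open>X\<close>, so its class contains the models of all of them.\<close>
  show "equational_class {e. satisfies X e} \<subseteq> generated_variety X"
    unfolding generated_variety_def equational_class_def by blast
qed

lemma generated_variety_in_BCRL_subvarieties:
  assumes "bcrl X"
  shows "generated_variety X \<in> BCRL_subvarieties"
proof -
  have "equational_class {e. satisfies X e} \<subseteq> BCRL"
    using bcrl_of_equations[OF assms] unfolding equational_class_def BCRL_def by blast
  then show ?thesis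
    unfolding BCRL_subvarieties_def generated_variety_eq[OF assms] by blast
qed

text \<open>An infinite \<open>'u\<close> has a subset of the size of \<open>X\<close>, and the
  operations are transported along a bijection. This gives a finite algebra over another type a
  member with the same identities in the varieties over \<open>'u\<close>.\<close>

lemma copy_of_finite_algebra:
  fixes X :: "'a bcrl_alg" (structure)
  assumes inf: "infinite (UNIV :: 'u set)" and "bcrl X" and fin: "finite (carrier X)"
  obtains Y :: "'u bcrl_alg"
  where "bcrl_subuniverse Y (carrier Y)" "\<And>e. satisfies Y e \<longleftrightarrow> satisfies X e"
proof -
  interpret bcrl X by fact
  obtain T :: "'u set" where "finite T" "card T = card (carrier X)"
    using infinite_arbitrarily_large[OF inf] by blast
  then obtain f where "bij_betw f (carrier X) T"
    using finite_same_card_bij fin by metis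
  then have inj: "inj_on f (carrier X)" by (simp add: bij_betw_def)
  let ?g = "inv_into (carrier X) f"
  define Y where "Y = \<lparr>carrier = f ` carrier X, mult = \<lambda>x y. f (?g x \<otimes> ?g y), one = f \<one>,
    vee = \<lambda>x y. f (?g x \<curlyvee> ?g y), wedge = \<lambda>x y. f (?g x \<curlywedge> ?g y),
    imp = \<lambda>x y. f (?g x \<leadsto> ?g y), zer = f \<zero>\<rparr>"
  have hom: "alg_hom X Y f"
    unfolding alg_hom_def Y_def by (simp add: inj)
  have surj: "f ` carrier X = carrier Y" by (simp add: Y_def)
  have "bcrl_subuniverse Y (carrier Y)"
    unfolding bcrl_subuniverse_def cirl_subuniverse_def Y_def
    using closed zer_closed by (auto simp: inj)
  moreover have "satisfies Y e \<longleftrightarrow> satisfies X e" for e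
    using satisfies_embedding[OF bcrl_subuniverse_carrier hom inj]
      satisfies_image[OF bcrl_subuniverse_carrier hom surj] by blast
  ultimately show thesis using that by blast
qed

lemma generated_variety_mono:
  assumes "bcrl X" "bcrl Y" "\<And>e. satisfies Y e \<Longrightarrow> satisfies X e"
  shows "generated_variety X \<subseteq> generated_variety Y"
  using assms(3) unfolding generated_variety_eq[OF assms(1)] generated_variety_eq[OF assms(2)]
  by (auto simp: equational_class_def)

text \<open>A converse of \<open>generated_variety_mono\<close>: a copy of \<open>X\<close> over
  \<open>'u\<close> lies in both classes and has the identities of \<open>X\<close>.\<close>

lemma satisfies_of_generated_variety_subset:
  assumes "infinite (UNIV :: 'u set)" "bcrl X" "finite (carrier X)" "bcrl Y"
    and "generated_variety X \<subseteq> (generated_variety Y :: 'u bcrl_alg set)" "satisfies Y e"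
  shows "satisfies X e"
proof -
  obtain Z :: "'u bcrl_alg" where
    Z: "bcrl_subuniverse Z (carrier Z)" "\<And>e. satisfies Z e \<longleftrightarrow> satisfies X e"
    using copy_of_finite_algebra[OF assms(1-3)] by blast
  then have "Z \<in> generated_variety X"
    unfolding generated_variety_eq[OF assms(2)] by (simp add: equational_class_def)
  then have "Z \<in> generated_variety Y" using assms(5) by blast
  then show ?thesis
    using assms(6) Z(2) unfolding generated_variety_eq[OF assms(4)] equational_class_def by blast
qed

text \<open>\<open>two\<close> embeds in \<open>B\<close>, so it satisfies the identities that
  define \<open>V\<close>.\<close>

lemma generated_variety_two_least:
  assumes V: "V \<in> BCRL_subvarieties" and B: "B \<in> V" "\<zero>\<^bsub>B\<^esub> \<noteq> \<one>\<^bsub>B\<^esub>"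
  shows "generated_variety two \<subseteq> V"
proof -
  obtain E where E: "V = equational_class E" using V BCRL_subvarieties_def by blast
  have "bcrl B" using V B(1) unfolding BCRL_subvarieties_def BCRL_def by blast
  then have "two \<in> equational_class E"
    using B satisfies_two bcrl.bcrl_subuniverse_carrier[OF bcrl_two]
    unfolding E equational_class_def by blast
  then show ?thesis unfolding E generated_variety_def by blast
qed

section \<open>The least element and the unique atom of the lattice\<close>

lemma trivial_variety:
  defines "T \<equiv> equational_class {(Var 0, Var 1)}"
  shows "T \<in> BCRL_subvarieties" "\<And>V. V \<in> BCRL_subvarieties \<Longrightarrow> T \<subseteq> V"
    "\<And>B. bcrl B \<Longrightarrow> B \<in> T \<longleftrightarrow> \<zero>\<^bsub>B\<^esub> = \<one>\<^bsub>B\<^esub>"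
proof -
  have T: "B \<in> T \<longleftrightarrow> bcrl_subuniverse B (carrier B) \<and> carrier B = {\<one>\<^bsub>B\<^esub>}" for B
  proof
    assume B: "B \<in> T"
    then have sub: "bcrl_subuniverse B (carrier B)" and sat: "satisfies B (Var 0, Var 1)"
      by (auto simp: T_def equational_class_def)
    have one: "\<one>\<^bsub>B\<^esub> \<in> carrier B"
      using sub by (simp add: bcrl_subuniverse_def cirl_subuniverse_def)
    \<comment> \<open>All variables but \<open>Var 0\<close> are sent to \<open>\<one>\<close>, so
      the identity reads \<open>x = \<one>\<close>.\<close>
    have "x = \<one>\<^bsub>B\<^esub>" if "x \<in> carrier B" for x
      using sat[unfolded satisfies_def, rule_format, of "\<lambda>i. if i = 0 then x else \<one>\<^bsub>B\<^esub>"] that one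
      by auto
    then show "bcrl_subuniverse B (carrier B) \<and> carrier B = {\<one>\<^bsub>B\<^esub>}"
      using sub one by blast
  next
    assume B: "bcrl_subuniverse B (carrier B) \<and> carrier B = {\<one>\<^bsub>B\<^esub>}"
    then show "B \<in> T" by (auto simp: T_def equational_class_def satisfies_def image_subset_iff)
  qed
  have "bcrl B" if "B \<in> T" for B
  proof -
    have c: "carrier B = {\<one>\<^bsub>B\<^esub>}" using that T by blast
    then have "\<one>\<^bsub>B\<^esub> \<otimes>\<^bsub>B\<^esub> \<one>\<^bsub>B\<^esub> = \<one>\<^bsub>B\<^esub>" "\<one>\<^bsub>B\<^esub> \<curlyvee>\<^bsub>B\<^esub> \<one>\<^bsub>B\<^esub> = \<one>\<^bsub>B\<^esub>" "\<one>\<^bsub>B\<^esub> \<curlywedge>\<^bsub>B\<^esub> \<one>\<^bsub>B\<^esub> = \<one>\<^bsub>B\<^esub>"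
      "\<one>\<^bsub>B\<^esub> \<leadsto>\<^bsub>B\<^esub> \<one>\<^bsub>B\<^esub> = \<one>\<^bsub>B\<^esub>" "\<zero>\<^bsub>B\<^esub> = \<one>\<^bsub>B\<^esub>"
      using that unfolding T bcrl_subuniverse_def cirl_subuniverse_def by auto
    then show ?thesis
      by unfold_locales (simp_all add: c leq_def)
  qed
  then show "T \<in> BCRL_subvarieties"
    unfolding BCRL_subvarieties_def BCRL_def T_def by blast
  show "T \<subseteq> V" if V: "V \<in> BCRL_subvarieties" for V
  proof
    fix B assume "B \<in> T"
    then have B: "bcrl_subuniverse B (carrier B)" "carrier B = {\<one>\<^bsub>B\<^esub>}" using T by auto
    \<comment> \<open>Every evaluation in a one-element algebra is \<open>\<one>\<close>.\<close>
    have "satisfies B e" for e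
      unfolding satisfies_def using eval_in_subuniverse[OF B(1)] B(2) by auto
    moreover obtain E where "V = equational_class E" using V BCRL_subvarieties_def by blast
    ultimately show "B \<in> V" using B(1) by (simp add: equational_class_def)
  qed
  show "B \<in> T \<longleftrightarrow> \<zero>\<^bsub>B\<^esub> = \<one>\<^bsub>B\<^esub>" if "bcrl B" for B
    using T bcrl.zero_neq_one_iff[OF that] bcrl.bcrl_subuniverse_carrier[OF that] by blast
qed

text \<open>A subvariety strictly above the trivial one has a member with
  \<open>\<zero> \<noteq> \<one>\<close>, hence contains the variety of \<open>two\<close>.\<close>

lemma atom_of_BCRL_subvarieties:
  assumes inf: "infinite (UNIV :: 'u set)"
  shows "atom_of BCRL_subvarieties (W :: 'u bcrl_alg set) \<longleftrightarrow> W = generated_variety two"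
proof -
  let ?V2 = "generated_variety two :: 'u bcrl_alg set"
  let ?T = "equational_class {(Var 0, Var 1)} :: 'u bcrl_alg set"
  note T = trivial_variety
  have V2: "?V2 \<in> BCRL_subvarieties"
    using generated_variety_in_BCRL_subvarieties[OF bcrl_two] .
  have "?V2 \<noteq> ?T"
  proof
    assume "?V2 = ?T"
    moreover obtain Z :: "'u bcrl_alg" where
      Z: "bcrl_subuniverse Z (carrier Z)" "\<And>e. satisfies Z e \<longleftrightarrow> satisfies two e"
      using copy_of_finite_algebra[OF inf bcrl_two] by (auto simp: two_def)
    moreover from Z have "Z \<in> ?V2"
      unfolding generated_variety_eq[OF bcrl_two] equational_class_def by blast
    ultimately have "satisfies two (Var 0, Var 1)"
      using Z(2) unfolding equational_class_def by blast
    \<comment> \<open>This valuation gives \<open>Var 0\<close> and \<open>Var 1\<close> the values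
      \<open>True\<close> and \<open>False\<close>.\<close>
    from this[unfolded satisfies_def, rule_format, of "\<lambda>i. i = 0"] show False
      by (simp add: two_def)
  qed
  then have lt: "?T < ?V2" using T(2)[OF V2] by blast
  have ge: "?V2 \<subseteq> V" if V: "V \<in> BCRL_subvarieties" "?T < V" for V
  proof -
    obtain B where B: "B \<in> V" "B \<notin> ?T" using V(2) by blast
    then have "bcrl B" using V(1) unfolding BCRL_subvarieties_def BCRL_def by blast
    then show ?thesis
      using generated_variety_two_least[OF V(1) B(1)] T(3) B(2) by blast
  qed
  have cov: "covers BCRL_subvarieties V ?T \<longleftrightarrow> V = ?V2" for V
    unfolding covers_def using lt ge T(1) V2 by blast
  show ?thesis
  proof
    assume "atom_of BCRL_subvarieties W"
    then obtain b where b: "b \<in> BCRL_subvarieties" "\<forall>z\<in>BCRL_subvarieties. b \<le> z"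
      "covers BCRL_subvarieties W b"
      unfolding atom_of_def by blast
    then have "b = ?T" using T(1) T(2)[OF b(1)] by blast
    then show "W = ?V2" using b(3) cov by blast
  next
    assume "W = ?V2"
    then show "atom_of BCRL_subvarieties W"
      unfolding atom_of_def using cov T(1,2) by blast
  qed
qed

section \<open>Almost minimality and rigidity for finite subdirectly irreducible algebras\<close>

lemma almost_minimal_imp_rigid:
  fixes A :: "'a bcrl_alg" (structure)
  assumes inf: "infinite (UNIV :: 'u set)"
    and A: "bcrl A" "finite (carrier A)" "subdirectly_irreducible A"
    and am: "almost_minimal (generated_variety A :: 'u bcrl_alg set)"
  shows "rigid A"
proof -
  interpret bcrl A by fact
  let ?V2 = "generated_variety two :: 'u bcrl_alg set"
  let ?V = "generated_variety A :: 'u bcrl_alg set"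
  have cov: "covers BCRL_subvarieties ?V ?V2"
    using am unfolding almost_minimal_def atom_of_BCRL_subvarieties[OF inf] by blast
  obtain c where "c \<in> carrier A" "c \<noteq> \<one>"
    using subdirectly_irreducible_filter_element[OF A(3)] by blast
  then have ne: "\<zero> \<noteq> \<one>" using zero_neq_one_iff by blast
  \<comment> \<open>With only \<open>\<zero>\<close> and \<open>\<one>\<close>, \<open>A\<close> is
    an image of \<open>two\<close> and generates the atom itself, not a cover of it.\<close>
  have "more_than_two (carrier A)"
  proof (rule ccontr)
    assume "\<not> more_than_two (carrier A)"
    then have "card (carrier A) \<le> card {\<zero>, \<one>}"
      using A(2) ne by (simp add: more_than_two_def)
    then have "carrier A = {\<zero>, \<one>}"
      using card_seteq[OF A(2), of "{\<zero>, \<one>}"] zer_closed one_closed by blast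
    then have "(\<lambda>b. if b then \<one> else \<zero>) ` carrier two = carrier A"
      by (auto simp: two_def)
    then have "satisfies A e" if "satisfies two e" for e
      using satisfies_image[OF bcrl.bcrl_subuniverse_carrier[OF bcrl_two] alg_hom_two[OF A(1)]] that
      by blast
    then have "?V \<subseteq> ?V2" using generated_variety_mono[OF A(1) bcrl_two] by blast
    then show False using cov by (auto simp: covers_def)
  qed
  moreover have "S = {\<zero>, \<one>}" if S: "bcrl_subuniverse A S" "S \<noteq> carrier A" for S
  proof (rule ccontr)
    assume "S \<noteq> {\<zero>, \<one>}"
    moreover have SA: "S \<subseteq> carrier A" "\<zero> \<in> S" "\<one> \<in> S"
      using S(1) unfolding bcrl_subuniverse_def cirl_subuniverse_def by blast+
    ultimately obtain a where a: "a \<in> S" "a \<noteq> \<zero>" "a \<noteq> \<one>" by blast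
    let ?X = "A\<lparr>carrier := S\<rparr>"
    have X: "bcrl ?X" using bcrl_subalgebra[OF A(1) S(1)] .
    have Xfin: "finite (carrier ?X)" using SA A(2) finite_subset by auto
    have "satisfies ?X e" if "satisfies A e" for e
      using that SA(1) unfolding satisfies_def by (auto simp: eval_subalgebra)
    then have "generated_variety ?X \<subseteq> ?V" using generated_variety_mono[OF X A(1)] by blast
    moreover have "?V2 \<subseteq> generated_variety ?X"
      using generated_variety_mono[OF bcrl_two X] satisfies_two[OF X] ne by simp
    moreover have "generated_variety ?X \<in> (BCRL_subvarieties :: 'u bcrl_alg set set)"
      using generated_variety_in_BCRL_subvarieties[OF X] .
    \<comment> \<open>The variety of the subalgebra lies between the atom and its cover; both
      extremes are now excluded.\<close>
    ultimately have "generated_variety ?X = ?V2 \<or> generated_variety ?X = ?V"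
      using cov unfolding covers_def by blast
    then show False
    proof
      assume "generated_variety ?X = ?V2"
      \<comment> \<open>Excluded middle, inherited from \<open>two\<close>, would make
        \<open>a\<close> complemented, against \<open>complement_trivial\<close>.\<close>
      moreover have "satisfies two (Vee (Var 0) (Imp (Var 0) Zer), One)"
        by (simp add: satisfies_def two_def)
      ultimately have "satisfies ?X (Vee (Var 0) (Imp (Var 0) Zer), One)"
        using satisfies_of_generated_variety_subset[OF inf X Xfin bcrl_two] by blast
      from this[unfolded satisfies_def, rule_format, of "\<lambda>_. a"]
      have "a \<curlyvee> (a \<leadsto> \<zero>) = \<one>" using a(1) by simp
      then show False using complement_trivial[OF A(3)] a SA(1) by blast
    next
      assume "generated_variety ?X = ?V"
      then have "satisfies A e" if "satisfies ?X e" for e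
        using satisfies_of_generated_variety_subset[OF inf A(1,2) X] that by blast
      \<comment> \<open>\<open>A\<close> would satisfy the identities of its proper subalgebra,
        although it has more elements.\<close>
      then have "card (carrier A) \<le> card (carrier ?X)"
        using card_le_of_satisfies[OF A X Xfin] by blast
      then show False
        using card_seteq[OF A(2) SA(1)] S(2) by simp
    qed
  qed
  ultimately show ?thesis using rigidI[OF A(1) _ A(3)] by blast
qed

lemma rigid_imp_almost_minimal:
  fixes A :: "'a bcrl_alg" (structure)
  assumes inf: "infinite (UNIV :: 'u set)" and fin: "finite (carrier A)" and rigid: "rigid A"
  shows "almost_minimal (generated_variety A :: 'u bcrl_alg set)"
proof -
  have A: "bcrl A" "more_than_two (carrier A)" "subdirectly_irreducible A"
    "\<And>S. bcrl_subuniverse A S \<Longrightarrow> S \<noteq> carrier A \<Longrightarrow> S = {\<zero>, \<one>}"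
    using rigid unfolding rigid_def by blast+
  interpret bcrl A by fact
  let ?V2 = "generated_variety two :: 'u bcrl_alg set"
  let ?V = "generated_variety A :: 'u bcrl_alg set"
  have card: "2 < card (carrier A)" using A(2) fin by (simp add: more_than_two_def)
  have "\<zero> \<noteq> \<one>" using card by (auto simp: zero_neq_one_iff)
  then have "?V2 \<subseteq> ?V"
    using generated_variety_mono[OF bcrl_two A(1)] satisfies_two[OF A(1)] by blast
  \<comment> \<open>\<open>A\<close> has too many elements to satisfy all identities of
    \<open>two\<close>.\<close>
  moreover have "\<not> ?V \<subseteq> ?V2"
  proof
    assume "?V \<subseteq> ?V2"
    then have "card (carrier A) \<le> card (carrier two)"
      using card_le_of_satisfies[OF A(1) fin A(3) bcrl_two]
        satisfies_of_generated_variety_subset[OF inf A(1) fin bcrl_two]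
      by (simp add: two_def)
    then show False using card by (simp add: two_def)
  qed
  moreover have False if Z: "Z \<in> BCRL_subvarieties" "?V2 < Z" "Z < ?V" for Z
  proof -
    obtain E where E: "Z = equational_class E" using Z(1) BCRL_subvarieties_def by blast
    have ZB: "bcrl B" if "B \<in> Z" for B
      using Z(1) that unfolding BCRL_subvarieties_def BCRL_def by blast
    have ZA: "satisfies B e" if "B \<in> Z" "satisfies A e" for B e
      using Z(3) that unfolding generated_variety_eq[OF A(1)] equational_class_def by blast
    obtain B where B: "B \<in> Z" "B \<notin> ?V2" using Z(2) by blast
    interpret B: bcrl B using ZB B(1) .
    obtain p q where pq: "satisfies two (p, q)" "\<not> satisfies B (p, q)"
      using B(2) B.bcrl_subuniverse_carrier
      unfolding generated_variety_eq[OF bcrl_two] equational_class_def by auto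
    \<comment> \<open>Brings the identity separating \<open>B\<close> from \<open>two\<close> into
      the form \<open>r = One\<close>.\<close>
    have bic: "satisfies C (Bicond p q, One) \<longleftrightarrow> satisfies C (p, q)" if "bcrl C" for C
    proof -
      interpret C: bcrl C by fact
      show ?thesis
        using C.bicond_eq_one_iff eval_in_subuniverse[OF C.bcrl_subuniverse_carrier]
        unfolding satisfies_def by (simp add: eval_Bicond)
    qed
    \<comment> \<open>A strictly intermediate \<open>Z\<close> is impossible: its member
      \<open>B\<close> makes it non-Boolean, so \<open>A\<close> satisfies the identities defining
      \<open>Z\<close>.\<close>
    have "satisfies A e" if "e \<in> E" for e
      using satisfies_of_nonboolean_class[OF A(1) fin A(4) ZB ZA B(1)]
        bic[OF bcrl_two] bic[OF ZB[OF B(1)]] pq that unfolding E equational_class_def by blast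
    then have "A \<in> equational_class E"
      using bcrl_subuniverse_carrier by (simp add: equational_class_def)
    then have "?V \<subseteq> Z" unfolding E generated_variety_def by blast
    then show False using Z(3) by blast
  qed
  ultimately have "covers BCRL_subvarieties ?V ?V2"
    unfolding covers_def
    using generated_variety_in_BCRL_subvarieties[OF bcrl_two]
      generated_variety_in_BCRL_subvarieties[OF A(1)] by blast
  then show ?thesis
    unfolding almost_minimal_def atom_of_BCRL_subvarieties[OF inf] by blast
qed

theorem theorem2p7:
  assumes "infinite (UNIV :: 'u set)"
  shows "(\<forall>A :: 'a bcrl_alg. bcrl A \<and> finite (carrier A) \<and> subdirectly_irreducible A \<longrightarrow>
            (almost_minimal (generated_variety A :: 'u bcrl_alg set) \<longleftrightarrow> rigid A)) \<and>
         (\<forall>A :: 'b bcrl_alg. bcrl A \<and> tight (zero_free_reduct A) \<longrightarrow> rigid A)"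
  using almost_minimal_imp_rigid[OF assms] rigid_imp_almost_minimal[OF assms] tight_imp_rigid
  by blast

end
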